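(* Let $k\ge2$, let $\Sigma_k=\{1,\dots,k\}^{\mathbb N_0}$ be the one-sided full shift with shift map $\sigma$, with metric $d_\theta(x,y)=\theta^{\min\{j\ge0:x_j\ne y_j\}}$ for $x\neq y$ and $d_\theta(x,x)=0$ ($0<\theta<1$ fixed). Let $C=(c_{ij})_{1\le i,j\le k}$ be a real matrix with all $c_{ij}>0$. For $1\le i\le k$ put $u_i=e_i\in\mathbb R^k$ (standard basis vector), $v_i=(c_{i1},\dots,c_{ik})^{\mathsf T}$, $A_i=u_iv_i^{\mathsf T}$. For $x=(x_j)_{j\ge0}\in\Sigma_k$ and $n\ge1$ set $A^{(n)}(x)=A_{x_{n-1}}\cdots A_{x_0}$ and $\phi_n^C(x)=\log\|A^{(n)}(x)\|$, where $\|\cdot\|$ is the Euclidean operator norm, and let $\Phi_C=\{\phi_n^C\}_{n\ge1}$. Then $\Phi_C$ is an orbit Lipschitz almost additive sequence. Moreover, $(\Sigma_k,\sigma)$ has relative $\Phi_C$-TPO. Hence there exists an open dense set $G\subset\operatorname{Lip}(\Sigma_k)$ such that for every $f\in G$ there is a periodic orbit $Q$ satisfying $$\mathcal M_{\max}\bigl(\Sigma_k,\sigma,(\Phi_C)^f\bigr)=\{\mu_Q\}.$$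
   Context: Let $(X,d)$ be compact metric and $T:X\to X$ continuous (here $X=\Sigma_k$, $T=\sigma$, $d=d_\theta$). A sequence $\Phi=\{\phi_n\}_{n\ge1}\subset C(X,\mathbb R)$ is almost additive if $\sup_{n,m\ge1}\|\phi_{n+m}-\phi_n-\phi_m\circ T^n\|_\infty<\infty$; it is orbit Lipschitz if $\sup_{n\ge1,x\ne y}|\phi_n(x)-\phi_n(y)|/\sum_{j=0}^{n-1}d(T^jx,T^jy)<\infty$. $\operatorname{Lip}(X)$ is the Banach space of real Lipschitz functions with norm $\|f\|_\infty+|f|_{\operatorname{Lip}}$. For $f\in\operatorname{Lip}(X)$, $\Phi^f=\{\phi_n+S_nf\}_{n\ge1}$ with $S_nf=\sum_{j=0}^{n-1}f\circ T^j$. For an almost additive $\Psi=\{\psi_n\}$ and a $T$-invariant Borel probability measure $\mu$, $\Psi_*(\mu)=\lim_n\frac1n\int\psi_n\,d\mu$ (exists), and $\mathcal M_{\max}(X,T,\Psi)$ is the set of invariant probability measures maximizing $\Psi_*$. $\mu_Q$ is the invariant probability measure on a periodic orbit $Q$. $(X,T)$ has relative $\Phi$-TPO if there is an open dense set of $f\in\operatorname{Lip}(X)$ with $\mathcal M_{\max}(X,T,\Phi^f)=\{\mu_Q\}$ for some periodic orbit $Q$ depending on $f$. *)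

theory Defs
  imports "HOL-Analysis.Analysis" "HOL-Probability.Probability_Measure"
begin

section \<open>Sequences of potentials over a compact metric space\<close>

text \<open>Throughout, \<open>m\<close> is a compact metric space (of type \<open>'a metric\<close>) and \<open>T\<close> a continuous
  self-map of it. A sequence \<open>\<phi>\<^sub>1, \<phi>\<^sub>2, \<dots>\<close> is a function on \<open>nat\<close> whose value at
  \<open>0\<close> is irrelevant.\<close>

definition almost_additive :: "'a metric \<Rightarrow> ('a \<Rightarrow> 'a) \<Rightarrow> (nat \<Rightarrow> 'a \<Rightarrow> real) \<Rightarrow> bool" where
  "almost_additive m T \<phi> \<longleftrightarrow>
     (\<forall>n\<ge>1. continuous_map (mtopology_of m) euclideanreal (\<phi> n)) \<and>
     bdd_above {\<bar>\<phi> (n + l) x - \<phi> n x - \<phi> l ((T ^^ n) x)\<bar> | n l x.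
                  1 \<le> n \<and> 1 \<le> l \<and> x \<in> mspace m}"

definition orbit_Lipschitz :: "'a metric \<Rightarrow> ('a \<Rightarrow> 'a) \<Rightarrow> (nat \<Rightarrow> 'a \<Rightarrow> real) \<Rightarrow> bool" where
  "orbit_Lipschitz m T \<phi> \<longleftrightarrow>
     bdd_above {\<bar>\<phi> n x - \<phi> n y\<bar> / (\<Sum>j<n. mdist m ((T ^^ j) x) ((T ^^ j) y)) | n x y.
                  1 \<le> n \<and> x \<in> mspace m \<and> y \<in> mspace m \<and> x \<noteq> y}"

definition perturb :: "('a \<Rightarrow> 'a) \<Rightarrow> (nat \<Rightarrow> 'a \<Rightarrow> real) \<Rightarrow> ('a \<Rightarrow> real) \<Rightarrow> nat \<Rightarrow> 'a \<Rightarrow> real" where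
  "perturb T \<phi> f n x = \<phi> n x + (\<Sum>j<n. f ((T ^^ j) x))"


section \<open>The space of Lipschitz functions\<close>

text \<open>Elements are normalised to be \<open>undefined\<close> outside the carrier, so that functions agreeing
  on the carrier are equal; this is vacuous when the carrier is \<open>UNIV\<close>.\<close>

definition lip_space :: "'a metric \<Rightarrow> ('a \<Rightarrow> real) set" where
  "lip_space m =
     {f \<in> extensional (mspace m). Lipschitz_continuous_map m euclidean_metric f}"

text \<open>In the seminorm, pairs with \<open>x = y\<close> contribute \<open>0 / 0 = 0\<close>.\<close>

definition lip_norm :: "'a metric \<Rightarrow> ('a \<Rightarrow> real) \<Rightarrow> real" where
  "lip_norm m f =
     (SUP x\<in>mspace m. \<bar>f x\<bar>) +
     (SUP (x, y)\<in>mspace m \<times> mspace m. \<bar>f x - f y\<bar> / mdist m x y)"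

text \<open>The distance induced by the norm. The guard is needed because \<^locale>\<open>Metric_space\<close> asks
  for nonnegativity also outside the carrier, where the suprema need not exist.\<close>

definition lip_dist :: "'a metric \<Rightarrow> ('a \<Rightarrow> real) \<Rightarrow> ('a \<Rightarrow> real) \<Rightarrow> real" where
  "lip_dist m f g =
     (if f \<in> lip_space m \<and> g \<in> lip_space m then lip_norm m (\<lambda>x. f x - g x) else 0)"

definition lip_metric :: "'a metric \<Rightarrow> ('a \<Rightarrow> real) metric" where
  "lip_metric m = metric (lip_space m, lip_dist m)"

lemma lip_norm_bounds:
  assumes "Lipschitz_continuous_map m euclidean_metric f"
    and "\<And>x y. x \<in> mspace m \<Longrightarrow> y \<in> mspace m \<Longrightarrow> mdist m x y \<le> B"
  shows "bdd_above ((\<lambda>x. \<bar>f x\<bar>) ` mspace m)"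
    and "bdd_above ((\<lambda>(x, y). \<bar>f x - f y\<bar> / mdist m x y) ` (mspace m \<times> mspace m))"
proof -
  obtain L where L: "L > 0" "\<forall>x\<in>mspace m. \<forall>y\<in>mspace m. dist (f x) (f y) \<le> L * mdist m x y"
    using assms(1) by (auto simp: Lipschitz_continuous_map_pos)
  show "bdd_above ((\<lambda>x. \<bar>f x\<bar>) ` mspace m)"
  proof (cases "mspace m = {}")
    case False
    then obtain a where a: "a \<in> mspace m" by blast
    show ?thesis
    proof (rule bdd_aboveI2)
      fix x assume x: "x \<in> mspace m"
      have "\<bar>f x - f a\<bar> \<le> L * mdist m x a" using L x a by (simp add: dist_real_def)
      also have "\<dots> \<le> L * B" using L assms(2) x a by (simp add: mult_left_mono)
      finally show "\<bar>f x\<bar> \<le> \<bar>f a\<bar> + L * B" by linarith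
    qed
  qed simp
  show "bdd_above ((\<lambda>(x, y). \<bar>f x - f y\<bar> / mdist m x y) ` (mspace m \<times> mspace m))"
  proof (rule bdd_aboveI2, clarify)
    fix x y assume xy: "x \<in> mspace m" "y \<in> mspace m"
    have "\<bar>f x - f y\<bar> \<le> L * mdist m x y" using L xy by (simp add: dist_real_def)
    moreover have "mdist m x y = 0 \<or> mdist m x y > 0" by (auto simp: less_le)
    ultimately show "\<bar>f x - f y\<bar> / mdist m x y \<le> L"
      using L(1) by (auto simp: divide_le_eq)
  qed
qed

lemma Lipschitz_continuous_map_diff_real:
  assumes "Lipschitz_continuous_map m euclidean_metric f"
    and "Lipschitz_continuous_map m euclidean_metric (g :: 'a \<Rightarrow> real)"
  shows "Lipschitz_continuous_map m euclidean_metric (\<lambda>x. f x - g x)"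
proof -
  obtain L K where L: "\<forall>x\<in>mspace m. \<forall>y\<in>mspace m. dist (f x) (f y) \<le> L * mdist m x y"
    and K: "\<forall>x\<in>mspace m. \<forall>y\<in>mspace m. dist (g x) (g y) \<le> K * mdist m x y"
    using assms by (auto simp: Lipschitz_continuous_map_def)
  have "dist (f x - g x) (f y - g y) \<le> (L + K) * mdist m x y"
    if "x \<in> mspace m" "y \<in> mspace m" for x y
  proof -
    have "dist (f x) (f y) \<le> L * mdist m x y" "dist (g x) (g y) \<le> K * mdist m x y"
      using L K that by auto
    then show ?thesis by (simp add: dist_real_def distrib_right)
  qed
  then show ?thesis by (auto simp: Lipschitz_continuous_map_def)
qed

lemma Metric_space_lip:
  assumes ne: "mspace m \<noteq> {}"
    and B: "\<And>x y. x \<in> mspace m \<Longrightarrow> y \<in> mspace m \<Longrightarrow> mdist m x y \<le> B"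
  shows "Metric_space (lip_space m) (lip_dist m)"
proof -
  let ?X = "mspace m"
  have lip: "Lipschitz_continuous_map m euclidean_metric (\<lambda>x. f x - g x)"
    if "f \<in> lip_space m" "g \<in> lip_space m" for f g
    using that by (auto simp: lip_space_def intro: Lipschitz_continuous_map_diff_real)
  have sup1: "\<bar>h x\<bar> \<le> (SUP x\<in>?X. \<bar>h x\<bar>)"
    if "Lipschitz_continuous_map m euclidean_metric h" "x \<in> ?X" for h :: "'a \<Rightarrow> real" and x
    using lip_norm_bounds(1)[OF that(1) B] that(2) by (intro cSUP_upper) auto
  have sup2: "\<bar>h x - h y\<bar> / mdist m x y \<le> (SUP (x, y)\<in>?X \<times> ?X. \<bar>h x - h y\<bar> / mdist m x y)"
    if "Lipschitz_continuous_map m euclidean_metric h" "x \<in> ?X" "y \<in> ?X"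
    for h :: "'a \<Rightarrow> real" and x y
    using cSUP_upper[OF _ lip_norm_bounds(2)[OF that(1) B], of "(x, y)"] that(2,3) by auto
  obtain a where a: "a \<in> ?X" using ne by blast
  have nn1: "0 \<le> (SUP x\<in>?X. \<bar>h x\<bar>)"
    if "Lipschitz_continuous_map m euclidean_metric h" for h :: "'a \<Rightarrow> real"
    using sup1[OF that a] by linarith
  have nn2: "0 \<le> (SUP (x, y)\<in>?X \<times> ?X. \<bar>h x - h y\<bar> / mdist m x y)"
    if "Lipschitz_continuous_map m euclidean_metric h" for h :: "'a \<Rightarrow> real"
    using sup2[OF that a a] by simp
  show ?thesis
  proof
    show "0 \<le> lip_dist m f g" for f g
      using nn1[OF lip] nn2[OF lip] by (auto simp: lip_dist_def lip_norm_def)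
    show "lip_dist m f g = lip_dist m g f" for f g
    proof -
      have "\<bar>(f x - g x) - (f y - g y)\<bar> = \<bar>(g x - f x) - (g y - f y)\<bar>" for x y by linarith
      then show ?thesis
        by (auto simp: lip_dist_def lip_norm_def abs_minus_commute[of "f _" "g _"])
    qed
    show "(lip_dist m f g = 0) = (f = g)" if f: "f \<in> lip_space m" and g: "g \<in> lip_space m" for f g
    proof
      assume "lip_dist m f g = 0"
      then have "(SUP x\<in>?X. \<bar>f x - g x\<bar>) = 0"
        using nn1[OF lip[OF f g]] nn2[OF lip[OF f g]] f g
        by (simp add: lip_dist_def lip_norm_def)
      then have "f x = g x" if "x \<in> ?X" for x using sup1[OF lip[OF f g] that] by simp
      then show "f = g" using f g by (auto simp: lip_space_def intro: extensionalityI)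
    next
      assume "f = g"
      then show "lip_dist m f g = 0"
        using ne by (simp add: lip_dist_def lip_norm_def case_prod_unfold)
    qed
    show "lip_dist m f h \<le> lip_dist m f g + lip_dist m g h"
      if f: "f \<in> lip_space m" and g: "g \<in> lip_space m" and h: "h \<in> lip_space m" for f g h
    proof -
      have "(SUP x\<in>?X. \<bar>f x - h x\<bar>) \<le> (SUP x\<in>?X. \<bar>f x - g x\<bar>) + (SUP x\<in>?X. \<bar>g x - h x\<bar>)"
      proof (rule cSUP_least[OF ne])
        fix x assume "x \<in> ?X"
        then show "\<bar>f x - h x\<bar> \<le> (SUP x\<in>?X. \<bar>f x - g x\<bar>) + (SUP x\<in>?X. \<bar>g x - h x\<bar>)"
          using sup1[OF lip[OF f g], of x] sup1[OF lip[OF g h], of x] by linarith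
      qed
      moreover have "(SUP (x, y)\<in>?X \<times> ?X. \<bar>(f x - h x) - (f y - h y)\<bar> / mdist m x y) \<le>
          (SUP (x, y)\<in>?X \<times> ?X. \<bar>(f x - g x) - (f y - g y)\<bar> / mdist m x y) +
          (SUP (x, y)\<in>?X \<times> ?X. \<bar>(g x - h x) - (g y - h y)\<bar> / mdist m x y)" (is "_ \<le> ?R")
      proof (rule cSUP_least, use ne in simp, clarify)
        fix x y assume xy: "x \<in> ?X" "y \<in> ?X"
        have "\<bar>(f x - h x) - (f y - h y)\<bar> / mdist m x y \<le>
            (\<bar>(f x - g x) - (f y - g y)\<bar> + \<bar>(g x - h x) - (g y - h y)\<bar>) / mdist m x y"
          by (intro divide_right_mono) auto
        also have "\<dots> \<le> ?R"
          using sup2[OF lip[OF f g] xy] sup2[OF lip[OF g h] xy] by (simp add: add_divide_distrib)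
        finally show "\<bar>(f x - h x) - (f y - h y)\<bar> / mdist m x y \<le> ?R" .
      qed
      ultimately show ?thesis using f g h by (simp add: lip_dist_def lip_norm_def)
    qed
  qed
qed


section \<open>Maximizing measures and relative TPO\<close>

definition mborel :: "'a metric \<Rightarrow> 'a measure" where
  "mborel m = sigma (mspace m) {U. openin (mtopology_of m) U}"

definition invariant_measures :: "'a metric \<Rightarrow> ('a \<Rightarrow> 'a) \<Rightarrow> 'a measure set" where
  "invariant_measures m T =
     {\<mu>. prob_space \<mu> \<and> sets \<mu> = sets (mborel m) \<and> T \<in> measurable \<mu> \<mu> \<and> distr \<mu> \<mu> T = \<mu>}"

definition mean_value :: "(nat \<Rightarrow> 'a \<Rightarrow> real) \<Rightarrow> 'a measure \<Rightarrow> real" where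
  "mean_value \<psi> \<mu> = lim (\<lambda>n. (1 / real n) * (\<integral>x. \<psi> n x \<partial>\<mu>))"

definition maximizing_measures ::
    "'a metric \<Rightarrow> ('a \<Rightarrow> 'a) \<Rightarrow> (nat \<Rightarrow> 'a \<Rightarrow> real) \<Rightarrow> 'a measure set" where
  "maximizing_measures m T \<psi> =
     {\<mu> \<in> invariant_measures m T. \<forall>\<nu>\<in>invariant_measures m T. mean_value \<psi> \<nu> \<le> mean_value \<psi> \<mu>}"

definition periodic_orbit :: "'a metric \<Rightarrow> ('a \<Rightarrow> 'a) \<Rightarrow> 'a set \<Rightarrow> bool" where
  "periodic_orbit m T Q \<longleftrightarrow>
     (\<exists>x\<in>mspace m. \<exists>p\<ge>1. (T ^^ p) x = x \<and> Q = (\<lambda>j. (T ^^ j) x) ` {..<p})"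

text \<open>The measure equidistributed on \<open>Q\<close>, viewed as a Borel measure on the whole space.\<close>

definition orbit_measure :: "'a metric \<Rightarrow> 'a set \<Rightarrow> 'a measure" where
  "orbit_measure m Q = distr (uniform_count_measure Q) (mborel m) (\<lambda>x. x)"

definition relative_TPO :: "'a metric \<Rightarrow> ('a \<Rightarrow> 'a) \<Rightarrow> (nat \<Rightarrow> 'a \<Rightarrow> real) \<Rightarrow> bool" where
  "relative_TPO m T \<phi> \<longleftrightarrow>
     (\<exists>G. openin (mtopology_of (lip_metric m)) G \<and>
          mtopology_of (lip_metric m) closure_of G = lip_space m \<and>
          (\<forall>f\<in>G. \<exists>Q. periodic_orbit m T Q \<and>
             maximizing_measures m T (perturb T \<phi> f) = {orbit_measure m Q}))"


section \<open>The full shift\<close>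

text \<open>The alphabet \<open>{1, \<dots>, k}\<close> is represented by a finite type \<open>'k\<close>, the shift space by the
  type \<open>nat \<Rightarrow> 'k\<close>.\<close>

definition shift :: "(nat \<Rightarrow> 'k) \<Rightarrow> nat \<Rightarrow> 'k" where
  "shift x = (\<lambda>n. x (Suc n))"

definition shift_dist :: "real \<Rightarrow> (nat \<Rightarrow> 'k) \<Rightarrow> (nat \<Rightarrow> 'k) \<Rightarrow> real" where
  "shift_dist \<theta> x y = (if x = y then 0 else \<theta> ^ (LEAST j. x j \<noteq> y j))"

definition shift_metric :: "real \<Rightarrow> (nat \<Rightarrow> 'k) metric" where
  "shift_metric \<theta> = metric (UNIV, shift_dist \<theta>)"

lemma Metric_space_shift_dist:
  assumes "0 < \<theta>" "\<theta> < 1"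
  shows "Metric_space UNIV (shift_dist \<theta> :: (nat \<Rightarrow> 'k) \<Rightarrow> _)"
proof
  fix x y z :: "nat \<Rightarrow> 'k"
  show nn: "0 \<le> shift_dist \<theta> x y" for x y :: "nat \<Rightarrow> 'k"
    using assms by (simp add: shift_dist_def)
  show "shift_dist \<theta> x y = shift_dist \<theta> y x"
    by (simp add: shift_dist_def eq_commute)
  show "(shift_dist \<theta> x y = 0) = (x = y)"
    using assms by (simp add: shift_dist_def)
  show "shift_dist \<theta> x z \<le> shift_dist \<theta> x y + shift_dist \<theta> y z"
  proof (cases "x = y \<or> y = z \<or> x = z")
    case True
    then show ?thesis using nn[of x y] nn[of y z] by (auto simp: shift_dist_def)
  next
    case False
    let ?j = "LEAST j. x j \<noteq> z j"
    have "\<exists>j. x j \<noteq> z j" using False by auto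
    then have "x ?j \<noteq> z ?j" by (rule LeastI_ex)
    then have "x ?j \<noteq> y ?j \<or> y ?j \<noteq> z ?j" by auto
    then have "(LEAST j. x j \<noteq> y j) \<le> ?j \<or> (LEAST j. y j \<noteq> z j) \<le> ?j"
      by (auto intro: Least_le)
    then have "\<theta> ^ ?j \<le> shift_dist \<theta> x y \<or> \<theta> ^ ?j \<le> shift_dist \<theta> y z"
      using assms False by (auto simp: shift_dist_def intro: power_decreasing)
    then show ?thesis using False nn[of x y] nn[of y z] by (auto simp: shift_dist_def)
  qed
qed

lemma
  assumes "0 < \<theta>" "\<theta> < 1"
  shows mspace_shift_metric: "mspace (shift_metric \<theta> :: (nat \<Rightarrow> 'k) metric) = UNIV"
    and mdist_shift_metric: "mdist (shift_metric \<theta> :: (nat \<Rightarrow> 'k) metric) = shift_dist \<theta>"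
  using Metric_space.mspace_metric[OF Metric_space_shift_dist[OF assms]]
    Metric_space.mdist_metric[OF Metric_space_shift_dist[OF assms]]
  by (auto simp: shift_metric_def)

lemma
  fixes m :: "(nat \<Rightarrow> 'k) metric"
  assumes "0 < \<theta>" "\<theta> < 1"
  defines "m \<equiv> shift_metric \<theta>"
  shows mspace_lip_shift: "mspace (lip_metric m) = lip_space m"
    and mdist_lip_shift: "mdist (lip_metric m) = lip_dist m"
proof -
  have "mdist m x y \<le> 1" for x y
    using assms by (simp add: m_def mdist_shift_metric shift_dist_def power_le_one)
  moreover have "mspace m \<noteq> {}"
    using assms by (simp add: m_def mspace_shift_metric)
  ultimately have ms: "Metric_space (lip_space m) (lip_dist m)"
    by (intro Metric_space_lip)
  show "mspace (lip_metric m) = lip_space m" "mdist (lip_metric m) = lip_dist m"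
    using Metric_space.mspace_metric[OF ms] Metric_space.mdist_metric[OF ms]
    by (auto simp: lip_metric_def)
qed


section \<open>The rank-one matrix cocycle\<close>

text \<open>\<open>A\<^sub>i = u\<^sub>i v\<^sub>i\<^sup>T\<close>, with \<open>u\<^sub>i\<close> the \<open>i\<close>-th standard basis vector as a \<open>k \<times> 1\<close> matrix and
  \<open>v\<^sub>i\<^sup>T\<close> the \<open>i\<close>-th row of \<open>C\<close> as a \<open>1 \<times> k\<close> matrix.\<close>

definition rank1_matrix :: "real ^ 'k ^ 'k \<Rightarrow> 'k \<Rightarrow> real ^ 'k ^ 'k" where
  "rank1_matrix C i =
     (columnvector (axis i 1) :: real ^ 1 ^ 'k) ** (rowvector (row i C) :: real ^ 'k ^ 1)"

primrec cocycle :: "real ^ 'k ^ 'k \<Rightarrow> nat \<Rightarrow> (nat \<Rightarrow> 'k) \<Rightarrow> real ^ 'k ^ 'k" where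
  "cocycle C 0 x = mat 1"
| "cocycle C (Suc n) x = rank1_matrix C (x n) ** cocycle C n x"

definition cocycle_potential :: "real ^ 'k ^ 'k \<Rightarrow> nat \<Rightarrow> (nat \<Rightarrow> 'k) \<Rightarrow> real" where
  "cocycle_potential C n x = ln (onorm (\<lambda>v. cocycle C n x *v v))"

end

theory Submission
  imports Defs
begin

text \<open>The matrices have rank one, so \<open>\<phi>\<^sub>n\<^sup>C x\<close> is, up to a bounded error, the Birkhoff sum of the
  locally constant function \<open>g x = ln (C $ x 1 $ x 0)\<close>, and \<open>\<Phi>\<^sub>C\<^sup>f\<close> has the same maximizing measures as
  the Lipschitz function \<open>g + f\<close>. What remains is Contreras's theorem for the full shift.

  By Mane's lemma a Lipschitz function is, up to a constant and a coboundary, a Lipschitz function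
  \<open>F \<le> 0\<close> that almost vanishes along arbitrarily long orbit segments. The words along which it does
  so form a factorial language; by an argument of Bressaud and Quas, cycles in its graph of
  \<open>m\<close>-blocks give periodic orbits of subexponential period along which \<open>\<bar>F\<bar> = O(\<theta>\<^sup>m)\<close>. Repeatedly
  splitting such an orbit at its closest pair of points, as in the proof of Huang, Lian, Ma, Xu and
  Zhang, leads to a periodic orbit \<open>Q\<close> for which the sum of \<open>- F\<close> over \<open>Q\<close> is as small as desired
  relative to the gap of \<open>Q\<close>. Subtracting a small multiple of the distance to \<open>Q\<close> then makes the
  measure on \<open>Q\<close> the unique maximizing one, and this persists under small perturbations: an orbit
  that leaves the neighbourhood of \<open>Q\<close> loses more at the exit than it can have gained before.\<close>

section \<open>The shift and Birkhoff sums\<close>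

text \<open>A split multiplies the loss \<open>- birkhoff F p x\<close> by up to a constant while at
  least halving the period, so the descent succeeds only if the initial orbit beats a high power of
  its period: \<open>real p ^ N * \<theta> ^ m\<close> must be small for arbitrary \<open>N\<close>.
  Pigeonhole on words of length \<open>m\<close> only gives periods of order
  \<open>exp (h * m)\<close>, with \<open>h\<close> the entropy of the language, which may be
  positive. Comparing long words with sets of blocks cancels \<open>h\<close>: there are at least
  \<open>exp (h * s * m)\<close> words made of \<open>s\<close> blocks, but at most about
  \<open>exp ((h + \<epsilon>) * s * m) / fact s\<close> sets of \<open>s\<close> blocks, and the
  factorial wins once \<open>s\<close> exceeds \<open>exp 1 * exp (\<epsilon> * m)\<close>. The
  measure side needs no ergodic theorem: an upper bound on Birkhoff sums, uniform in time and point,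
  makes the integral nonpositive for every invariant measure. The penalty is spent in two halves,
  one for this bound and one for strictness. The orbit and the admissible size of a perturbation are
  fixed before the perturbation itself, which is what yields a whole ball of functions with the same
  maximizing measure.\<close>

lemma funpow_shift: "(shift ^^ n) x i = x (n + i)"
  by (induction n arbitrary: x i) (auto simp: shift_def)

lemma funpow_shift_add: "(shift ^^ (n + l)) x = (shift ^^ l) ((shift ^^ n) x)"
  by (auto simp: fun_eq_iff funpow_shift add_ac)

definition birkhoff :: "((nat \<Rightarrow> 'k) \<Rightarrow> real) \<Rightarrow> nat \<Rightarrow> (nat \<Rightarrow> 'k) \<Rightarrow> real" where
  "birkhoff f n x = (\<Sum>j<n. f ((shift ^^ j) x))"

lemma birkhoff_0 [simp]: "birkhoff f 0 x = 0"
  by (simp add: birkhoff_def)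

lemma birkhoff_Suc: "birkhoff f (Suc n) x = birkhoff f n x + f ((shift ^^ n) x)"
  by (simp add: birkhoff_def)

lemma birkhoff_add: "birkhoff f (n + l) x = birkhoff f n x + birkhoff f l ((shift ^^ n) x)"
  by (induction l) (simp_all add: birkhoff_Suc funpow_shift_add)

lemma birkhoff_minus_const: "birkhoff (\<lambda>x. f x - c) n x = birkhoff f n x - real n * c"
  by (simp add: birkhoff_def sum_subtractf)

lemma birkhoff_coboundary:
  "birkhoff (\<lambda>x. u x - u (shift x)) n x = u x - u ((shift ^^ n) x)"
  by (induction n) (simp_all add: birkhoff_Suc)

lemma birkhoff_plus: "birkhoff (\<lambda>x. f x + g x) n x = birkhoff f n x + birkhoff g n x"
  by (simp add: birkhoff_def sum.distrib)

lemma birkhoff_mono: "(\<And>x. f x \<le> g x) \<Longrightarrow> birkhoff f n x \<le> birkhoff g n x"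
  by (simp add: birkhoff_def sum_mono)

lemma funpow_shift_periodic:
  assumes "(shift ^^ p) x = x"
  shows "(shift ^^ (n * p)) x = x"
  using assms by (induction n) (simp_all add: funpow_shift_add)

lemma funpow_shift_mod:
  assumes "(shift ^^ p) x = x"
  shows "(shift ^^ (n mod p)) x = (shift ^^ n) x"
  using funpow_shift_add[of "n div p * p" "n mod p" x] funpow_shift_periodic[OF assms] by simp

lemma funpow_shift_periodic_iterate:
  assumes "(shift ^^ p) x = x"
  shows "(shift ^^ p) ((shift ^^ c) x) = (shift ^^ c) x"
  by (metis add.commute assms funpow_shift_add)

lemma birkhoff_periodic:
  assumes "(shift ^^ p) x = x"
  shows "birkhoff f (n * p) x = real n * birkhoff f p x"
  using assms
  by (induction n) (simp_all add: birkhoff_add algebra_simps funpow_shift_periodic)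

lemma birkhoff_cyclic:
  assumes "(shift ^^ p) x = x"
  shows "birkhoff f p ((shift ^^ c) x) = birkhoff f p x"
  using birkhoff_add[of f p c x] birkhoff_add[of f c p x] assms by (simp add: add.commute)

section \<open>The metric on the shift, explicit Lipschitz constants, shadowing\<close>

locale shift_space =
  fixes \<theta> :: real
  assumes theta_pos: "0 < \<theta>" and theta_less: "\<theta> < 1"
begin

abbreviation sd :: "(nat \<Rightarrow> 'k) \<Rightarrow> (nat \<Rightarrow> 'k) \<Rightarrow> real" where
  "sd \<equiv> shift_dist \<theta>"

lemma sd_metric: "Metric_space UNIV (sd :: (nat \<Rightarrow> 'k) \<Rightarrow> _)"
  by (rule Metric_space_shift_dist[OF theta_pos theta_less])

lemma sd_nonneg [simp]: "0 \<le> sd x y"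
  using theta_pos by (simp add: shift_dist_def)

lemma sd_le_1: "sd x y \<le> 1"
  using theta_pos theta_less by (simp add: shift_dist_def power_le_one)

lemma sd_self [simp]: "sd x x = 0"
  by (simp add: shift_dist_def)

lemma sd_eq_0_iff: "sd x y = 0 \<longleftrightarrow> x = y"
  using theta_pos by (simp add: shift_dist_def)

lemma sd_commute: "sd x y = sd y x"
  by (simp add: shift_dist_def eq_commute)

lemma sd_triangle: "sd x z \<le> sd x y + sd y z"
  using Metric_space.triangle[OF sd_metric] by auto

lemma sd_power:
  assumes "x \<noteq> y"
  obtains R where "sd x y = \<theta> ^ R" "\<forall>i<R. x i = y i" "x R \<noteq> y R"
proof
  show "sd x y = \<theta> ^ (LEAST j. x j \<noteq> y j)" using assms by (simp add: shift_dist_def)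
  show "\<forall>i<(LEAST j. x j \<noteq> y j). x i = y i" using not_less_Least by blast
  show "x (LEAST j. x j \<noteq> y j) \<noteq> y (LEAST j. x j \<noteq> y j)"
    by (rule LeastI_ex) (use assms in auto)
qed

lemma sd_le_power_iff: "sd x y \<le> \<theta> ^ n \<longleftrightarrow> (\<forall>i<n. x i = y i)"
proof (cases "x = y")
  case True
  then show ?thesis using theta_pos by simp
next
  case False
  then obtain R where R: "sd x y = \<theta> ^ R" "\<forall>i<R. x i = y i" "x R \<noteq> y R"
    by (rule sd_power)
  have "\<theta> ^ R \<le> \<theta> ^ n \<longleftrightarrow> n \<le> R"
    using theta_pos theta_less by (simp add: power_decreasing_iff)
  also have "\<dots> \<longleftrightarrow> (\<forall>i<n. x i = y i)"
    using R(2,3) by (meson leI less_le_trans)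
  finally show ?thesis using R(1) by simp
qed

lemma sd_less_power_iff: "sd x y < \<theta> ^ n \<longleftrightarrow> (\<forall>i\<le>n. x i = y i)"
proof (cases "x = y")
  case True
  then show ?thesis using theta_pos by simp
next
  case False
  then obtain R where R: "sd x y = \<theta> ^ R" "\<forall>i<R. x i = y i" "x R \<noteq> y R"
    by (rule sd_power)
  have "\<theta> ^ R < \<theta> ^ n \<longleftrightarrow> n < R"
    using theta_pos theta_less by (simp add: power_strict_decreasing_iff)
  also have "\<dots> \<longleftrightarrow> (\<forall>i\<le>n. x i = y i)"
    using R(2,3) by (meson leI le_less_trans)
  finally show ?thesis using R(1) by simp
qed

lemma sd_shift:
  assumes "x 0 = y 0"
  shows "sd x y = \<theta> * sd (shift x) (shift y)"
proof (cases "x = y")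
  case False
  then obtain R where R: "sd x y = \<theta> ^ R" "\<forall>i<R. x i = y i" "x R \<noteq> y R"
    by (rule sd_power)
  have "R \<noteq> 0" using R(3) assms by metis
  then obtain R' where R': "R = Suc R'" by (cases R) auto
  have "shift x \<noteq> shift y" using R(3) R' by (metis shift_def)
  then obtain S where S: "sd (shift x) (shift y) = \<theta> ^ S"
    "\<forall>i<S. shift x i = shift y i" "shift x S \<noteq> shift y S"
    by (rule sd_power)
  have "S = R'"
    using R S R' by (metis linorder_neqE_nat Suc_less_eq shift_def)
  then show ?thesis using R(1) S(1) R' by simp
qed simp

lemma sd_funpow_shift:
  assumes "\<And>i. i < n \<Longrightarrow> x i = y i"
  shows "sd x y = \<theta> ^ n * sd ((shift ^^ n) x) ((shift ^^ n) y)"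
  using assms
proof (induction n)
  case (Suc n)
  have "sd ((shift ^^ n) x) ((shift ^^ n) y)
      = \<theta> * sd (shift ((shift ^^ n) x)) (shift ((shift ^^ n) y))"
    by (rule sd_shift) (simp add: funpow_shift Suc.prems)
  then show ?case using Suc by simp
qed simp

lemma sd_funpow_shift':
  assumes "\<And>i. i < n \<Longrightarrow> x i = y i" "j \<le> n"
  shows "sd ((shift ^^ j) x) ((shift ^^ j) y) = \<theta> ^ (n - j) * sd ((shift ^^ n) x) ((shift ^^ n) y)"
  using sd_funpow_shift[of "n - j" "(shift ^^ j) x" "(shift ^^ j) y"] assms
  by (simp add: funpow_shift flip: funpow_shift_add)

lemma sd_shift_le: "sd (shift x) (shift y) \<le> sd x y / \<theta>"
proof (cases "x 0 = y 0")
  case True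
  then show ?thesis using theta_pos by (simp add: sd_shift)
next
  case False
  then have "\<not> sd x y < \<theta> ^ 0" unfolding sd_less_power_iff by blast
  then have "1 / \<theta> \<le> sd x y / \<theta>" using theta_pos by (simp add: divide_right_mono)
  moreover have "1 \<le> 1 / \<theta>" using theta_pos theta_less by simp
  ultimately show ?thesis using sd_le_1[of "shift x" "shift y"] by linarith
qed

lemma sum_theta_powers: "(\<Sum>j<n. \<theta> ^ (n - j)) \<le> 1 / (1 - \<theta>)"
proof -
  have "(\<Sum>j<n. \<theta> ^ (n - j)) \<le> (1 - \<theta> ^ n) / (1 - \<theta>)"
  proof (induction n)
    case (Suc n)
    have "(\<Sum>j<Suc n. \<theta> ^ (Suc n - j)) = \<theta> * (\<Sum>j<n. \<theta> ^ (n - j)) + \<theta>"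
      by (simp add: sum_distrib_left Suc_diff_le)
    also have "\<dots> \<le> \<theta> * ((1 - \<theta> ^ n) / (1 - \<theta>)) + 1"
      using Suc theta_pos theta_less by (intro add_mono mult_left_mono) auto
    also have "\<dots> = (1 - \<theta> ^ Suc n) / (1 - \<theta>)"
      using theta_less by (simp add: field_simps)
    finally show ?case .
  qed simp
  also have "\<dots> \<le> 1 / (1 - \<theta>)"
    using theta_pos theta_less by (intro divide_right_mono) auto
  finally show ?thesis .
qed

definition slip :: "real \<Rightarrow> ((nat \<Rightarrow> 'k) \<Rightarrow> real) \<Rightarrow> bool" where
  "slip K f \<longleftrightarrow> (\<forall>x y. \<bar>f x - f y\<bar> \<le> K * sd x y)"

lemma slipD: "slip K f \<Longrightarrow> \<bar>f x - f y\<bar> \<le> K * sd x y"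
  by (simp add: slip_def)

lemma slip_mono:
  assumes "slip K f" "K \<le> K'"
  shows "slip K' f"
  unfolding slip_def by (meson assms mult_right_mono order_trans sd_nonneg slipD)

lemma slip_add:
  assumes "slip K f" "slip K' g"
  shows "slip (K + K') (\<lambda>x. f x + g x)"
  unfolding slip_def
proof (intro allI)
  fix x y
  show "\<bar>f x + g x - (f y + g y)\<bar> \<le> (K + K') * sd x y"
    using slipD[OF assms(1), of x y] slipD[OF assms(2), of x y] by (simp add: distrib_right)
qed

lemma slip_uminus: "slip K f \<Longrightarrow> slip K (\<lambda>x. - f x)"
  by (simp add: slip_def abs_minus_commute)

lemma slip_const: "slip 0 (\<lambda>x. c)"
  by (simp add: slip_def)

lemma slip_cmult:
  assumes "slip K f" "0 \<le> c"
  shows "slip (c * K) (\<lambda>x. c * f x)"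
  unfolding slip_def
proof (intro allI)
  fix x y
  have "\<bar>c * f x - c * f y\<bar> = c * \<bar>f x - f y\<bar>"
    using assms(2) by (simp add: abs_mult flip: right_diff_distrib)
  then show "\<bar>c * f x - c * f y\<bar> \<le> c * K * sd x y"
    using mult_left_mono[OF slipD[OF assms(1), of x y] assms(2)] by simp
qed

lemma slip_shift:
  assumes "slip K f" "0 \<le> K"
  shows "slip (K / \<theta>) (\<lambda>x. f (shift x))"
  unfolding slip_def
proof (intro allI)
  fix x y
  have "\<bar>f (shift x) - f (shift y)\<bar> \<le> K * (sd x y / \<theta>)"
    using slipD[OF assms(1)] mult_left_mono[OF sd_shift_le assms(2)] order_trans by blast
  then show "\<bar>f (shift x) - f (shift y)\<bar> \<le> K / \<theta> * sd x y" by simp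
qed

text \<open>Backward contraction: two orbits following the same \<open>n\<close> symbols are exponentially close
  away from the end, so their Birkhoff sums differ boundedly.\<close>

lemma birkhoff_shadow:
  assumes f: "slip K f" and K: "0 \<le> K" and eq: "\<And>i. i < n \<Longrightarrow> x i = y i"
  shows "\<bar>birkhoff f n x - birkhoff f n y\<bar> \<le> K / (1 - \<theta>) * sd ((shift ^^ n) x) ((shift ^^ n) y)"
proof -
  let ?D = "sd ((shift ^^ n) x) ((shift ^^ n) y)"
  have "\<bar>birkhoff f n x - birkhoff f n y\<bar>
      \<le> (\<Sum>j<n. \<bar>f ((shift ^^ j) x) - f ((shift ^^ j) y)\<bar>)"
    by (simp add: birkhoff_def sum_abs flip: sum_subtractf)
  also have "\<dots> \<le> (\<Sum>j<n. K * (\<theta> ^ (n - j) * ?D))"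
  proof (rule sum_mono)
    fix j assume "j \<in> {..<n}"
    then have "sd ((shift ^^ j) x) ((shift ^^ j) y) = \<theta> ^ (n - j) * ?D"
      by (intro sd_funpow_shift') (auto simp: eq)
    then show "\<bar>f ((shift ^^ j) x) - f ((shift ^^ j) y)\<bar> \<le> K * (\<theta> ^ (n - j) * ?D)"
      using slipD[OF f, of "(shift ^^ j) x" "(shift ^^ j) y"] by simp
  qed
  also have "\<dots> = K * ?D * (\<Sum>j<n. \<theta> ^ (n - j))"
    unfolding sum_distrib_left by (simp add: mult_ac)
  also have "\<dots> \<le> K * ?D * (1 / (1 - \<theta>))"
    using K by (intro mult_left_mono sum_theta_powers) auto
  finally show ?thesis by (simp add: mult_ac)
qed

lemma birkhoff_shadow_le:
  assumes "slip K f" "0 \<le> K" "\<And>i. i < n \<Longrightarrow> x i = y i"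
  shows "\<bar>birkhoff f n x - birkhoff f n y\<bar> \<le> K / (1 - \<theta>)"
proof -
  have "K / (1 - \<theta>) * sd ((shift ^^ n) x) ((shift ^^ n) y) \<le> K / (1 - \<theta>) * 1"
    using assms(2) theta_less by (intro mult_left_mono sd_le_1) auto
  then show ?thesis using birkhoff_shadow[OF assms(1,2), of n x y] assms(3) by simp
qed

end

section \<open>Mane's lemma\<close>

lemma periodic_extension:
  fixes x :: "nat \<Rightarrow> 'k"
  assumes "1 \<le> n"
  shows "(shift ^^ n) (\<lambda>i. x (i mod n)) = (\<lambda>i. x (i mod n))"
  by (auto simp: fun_eq_iff funpow_shift)

context shift_space
begin

text \<open>The coboundary comes from the sub-action
  \<open>u x = (SUP (n, y) with \<sigma>\<^sup>n y = x. S\<^sub>n (A - \<beta>) y)\<close>, and \<open>\<beta>\<close> is the largest mean over a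
  periodic orbit.\<close>

lemma mane:
  fixes A :: "(nat \<Rightarrow> 'k) \<Rightarrow> real"
  assumes A: "slip L A" and L: "0 \<le> L"
  obtains F u \<beta> K where
    "0 \<le> K" "slip K F" "slip K u" "\<And>x. F x = (A x - \<beta>) + (u x - u (shift x))" "\<And>x. F x \<le> 0"
    "\<And>n \<eta>. 0 < \<eta> \<Longrightarrow> \<exists>x. \<forall>j<n. - \<eta> \<le> F ((shift ^^ j) x)"
proof -
  define P where "P = {birkhoff A p y / real p | p y. 1 \<le> p \<and> (shift ^^ p) y = y}"
  define \<beta> where "\<beta> = Sup P"
  define C where "C = L / (1 - \<theta>)"
  have C: "0 \<le> C" using L theta_less by (simp add: C_def)
  fix z :: 'k
  let ?z = "\<lambda>i::nat. z"
  have "birkhoff A 1 ?z / real 1 \<in> P"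
    by (force simp: P_def shift_def)
  then have P_ne: "P \<noteq> {}" by blast
  have A_le: "A x \<le> A ?z + L" for x
    using slipD[OF A, of x ?z] mult_left_mono[OF sd_le_1[of x ?z] L] by simp
  have P_bdd: "bdd_above P"
  proof (rule bdd_aboveI)
    fix a assume "a \<in> P"
    then obtain p y where p: "a = birkhoff A p y / real p" "1 \<le> p" by (auto simp: P_def)
    have "birkhoff A p y \<le> real p * (A ?z + L)"
      using sum_bounded_above[of "{..<p}" "\<lambda>j. A ((shift ^^ j) y)" "A ?z + L"] A_le
      by (simp add: birkhoff_def)
    then show "a \<le> A ?z + L" using p by (simp add: divide_le_eq mult.commute)
  qed
  have periodic_le: "birkhoff A p y \<le> real p * \<beta>" if "1 \<le> p" "(shift ^^ p) y = y" for p y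
  proof -
    have "birkhoff A p y / real p \<le> \<beta>"
      unfolding \<beta>_def using that by (intro cSup_upper P_bdd) (auto simp: P_def)
    then show ?thesis using that(1) by (simp add: divide_le_eq mult.commute)
  qed
  let ?A = "\<lambda>x. A x - \<beta>"
  have A': "slip L ?A" using slip_add[OF A slip_const[of "-\<beta>"]] by simp
  have bound: "birkhoff ?A n y \<le> C" for n y
  proof (cases "n = 0")
    case False
    \<comment> \<open>Repeating the first \<open>n\<close> symbols gives a periodic point, whose sum
      of \<open>A - \<beta>\<close> is at most 0 by the choice of \<open>\<beta>\<close>; shadowing
      costs \<open>C\<close>. Hence the supremum defining \<open>u\<close> is finite.\<close>
    let ?y = "\<lambda>i. y (i mod n)"
    have "\<bar>birkhoff ?A n y - birkhoff ?A n ?y\<bar> \<le> C"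
      unfolding C_def by (rule birkhoff_shadow_le[OF A' L]) simp
    moreover have "birkhoff ?A n ?y \<le> 0"
      using periodic_le[OF _ periodic_extension, of n y] False by (simp add: birkhoff_minus_const)
    ultimately show ?thesis by linarith
  qed (use C in simp)
  define V where "V x = {birkhoff ?A n y | n y. (shift ^^ n) y = x}" for x
  define u where "u x = Sup (V x)" for x
  have V_bdd: "bdd_above (V x)" for x
    using bound by (auto simp: V_def intro!: bdd_aboveI)
  have "birkhoff ?A 0 x \<in> V x" for x
    unfolding V_def by (intro CollectI exI[of _ 0] exI[of _ x]) simp
  then have V_ne: "V x \<noteq> {}" for x by blast
  have u_le: "u x \<le> u y + C * sd x y" for x y
    unfolding u_def[of x]
  proof (rule cSup_least[OF V_ne])
    fix a assume "a \<in> V x"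
    then obtain n w where a: "a = birkhoff ?A n w" and w: "(shift ^^ n) w = x"
      by (auto simp: V_def)
    \<comment> \<open>The past \<open>w\<close> of \<open>x\<close> is glued onto \<open>y\<close>:
      every preimage branch of \<open>x\<close> has a partner over \<open>y\<close>, so the two
      suprema differ by the shadowing error only.\<close>
    define w' where "w' i = (if i < n then w i else y (i - n))" for i
    have w': "(shift ^^ n) w' = y" by (auto simp: fun_eq_iff funpow_shift w'_def)
    have "birkhoff ?A n w' \<le> u y"
      unfolding u_def using w' by (intro cSup_upper V_bdd) (auto simp: V_def)
    moreover have "\<bar>birkhoff ?A n w - birkhoff ?A n w'\<bar> \<le> C * sd x y"
      using birkhoff_shadow[OF A' L, of n w w'] w w' by (simp add: w'_def C_def)
    ultimately show "a \<le> u y + C * sd x y" using a by linarith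
  qed
  have u: "slip C u"
    unfolding slip_def
  proof (intro allI)
    fix x y
    show "\<bar>u x - u y\<bar> \<le> C * sd x y"
      using u_le[of x y] u_le[of y x] sd_commute[of x y] by (simp add: abs_le_iff)
  qed
  have u_shift: "u x + ?A x \<le> u (shift x)" for x
  proof -
    have "u x \<le> u (shift x) - ?A x"
      unfolding u_def[of x]
    proof (rule cSup_least[OF V_ne])
      fix a assume "a \<in> V x"
      then obtain n w where a: "a = birkhoff ?A n w" and w: "(shift ^^ n) w = x"
        by (auto simp: V_def)
      have "birkhoff ?A (Suc n) w \<le> u (shift x)"
        unfolding u_def V_def using w
        by (intro cSup_upper V_bdd[unfolded V_def] CollectI exI[of _ "Suc n"] exI[of _ w]) simp
      then show "a \<le> u (shift x) - ?A x" using a w by (simp add: birkhoff_Suc)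
    qed
    then show ?thesis by linarith
  qed
  define F where "F x = ?A x + (u x - u (shift x))" for x
  define K where "K = L + (C + C / \<theta>)"
  have "0 \<le> C / \<theta>" using C theta_pos by simp
  show ?thesis
  proof
    show "0 \<le> K" using L C \<open>0 \<le> C / \<theta>\<close> by (simp add: K_def)
    show "slip K F"
      unfolding F_def K_def
      using slip_add[OF A' slip_add[OF u slip_uminus[OF slip_shift[OF u C]]]] by simp
    show "slip K u" by (rule slip_mono[OF u]) (use L \<open>0 \<le> C / \<theta>\<close> in \<open>simp add: K_def\<close>)
    show "F x = ?A x + (u x - u (shift x))" for x by (simp add: F_def)
    show "F x \<le> 0" for x using u_shift[of x] by (simp add: F_def)
    then have F_le: "F x \<le> 0" for x .
    show "\<exists>x. \<forall>j<n. - \<eta> \<le> F ((shift ^^ j) x)" if "0 < \<eta>" for n \<eta>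
    proof (rule ccontr)
      \<comment> \<open>Every stretch of \<open>n\<close> steps would then lose at least
        \<open>\<eta>\<close>. The coboundary does not change sums over periodic orbits, so all
        periodic means of \<open>A\<close> would be at most \<open>\<beta> - \<eta> / n\<close>,
        although \<open>\<beta>\<close> is their supremum.\<close>
      assume neg: "\<nexists>x. \<forall>j<n. - \<eta> \<le> F ((shift ^^ j) x)"
      then have n: "0 < n" by (cases n) auto
      have block: "birkhoff F n x \<le> - \<eta>" for x
      proof -
        obtain j where j: "j < n" "F ((shift ^^ j) x) < - \<eta>"
          using neg by (meson not_le)
        have "birkhoff F n x = F ((shift ^^ j) x) + (\<Sum>i\<in>{..<n} - {j}. F ((shift ^^ i) x))"
          unfolding birkhoff_def using j by (subst sum.remove[of _ j]) auto
        also have "\<dots> \<le> - \<eta> + 0"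
          using j F_le by (intro add_mono sum_nonpos) auto
        finally show ?thesis by simp
      qed
      have blocks: "birkhoff F (p * n) x \<le> - real p * \<eta>" for p x
      proof (induction p)
        case (Suc p)
        have "birkhoff F (Suc p * n) x = birkhoff F (p * n) x + birkhoff F n ((shift ^^ (p * n)) x)"
          by (simp add: birkhoff_add[symmetric] add.commute)
        then show ?case using Suc block[of "(shift ^^ (p * n)) x"] by (simp add: algebra_simps)
      qed simp
      have "\<beta> \<le> \<beta> - \<eta> / n"
        unfolding \<beta>_def[symmetric]
      proof (subst (1) \<beta>_def, rule cSup_least[OF P_ne])
        fix a assume "a \<in> P"
        then obtain p y where p: "a = birkhoff A p y / real p" "1 \<le> p" "(shift ^^ p) y = y"
          by (auto simp: P_def)
        have "birkhoff F p y = birkhoff A p y - real p * \<beta>"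
          unfolding F_def birkhoff_plus birkhoff_coboundary birkhoff_minus_const using p by simp
        then have "real n * (birkhoff A p y - real p * \<beta>) \<le> - real p * \<eta>"
          using blocks[of p y] birkhoff_periodic[OF p(3), of F n] by (simp add: mult.commute)
        moreover have "birkhoff A p y = a * real p" using p(1,2) by simp
        ultimately have "(real n * (a - \<beta>) + \<eta>) * real p \<le> 0" by (simp add: algebra_simps)
        then have "real n * (a - \<beta>) + \<eta> \<le> 0" using p(2) by (simp add: mult_le_0_iff)
        then show "a \<le> \<beta> - \<eta> / n"
          using n by (simp add: field_simps)
      qed
      then show False using n that by (simp add: divide_le_0_iff)
    qed
  qed
qed

end

section \<open>Factorial languages\<close>

locale factorial_language =
  fixes L :: "'k::finite list set"
  assumes factor: "u @ v @ w \<in> L \<Longrightarrow> v \<in> L"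
    and long_words: "\<exists>w\<in>L. length w = n"
begin

definition words :: "nat \<Rightarrow> 'k list set" where
  "words n = {w \<in> L. length w = n}"

lemma finite_words [simp]: "finite (words n)"
  by (rule finite_subset[OF _ finite_lists_length_eq[of UNIV n]]) (auto simp: words_def)

lemma card_words_pos: "1 \<le> card (words n)"
proof -
  have "words n \<noteq> {}" using long_words[of n] by (auto simp: words_def)
  then show ?thesis by (simp add: Suc_le_eq card_gt_0_iff)
qed

lemma factor_take_drop: "w \<in> L \<Longrightarrow> take n (drop l w) \<in> L"
  using factor[of "take l w" "take n (drop l w)" "drop n (drop l w)"]
  by (simp only: append_take_drop_id)

lemma take_in: "w \<in> L \<Longrightarrow> take n w \<in> L" and drop_in: "w \<in> L \<Longrightarrow> drop l w \<in> L"
  using factor_take_drop[of w n 0] factor[of "take l w" "drop l w" "[]"] by simp_all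

lemma card_words_add: "card (words (a + b)) \<le> card (words a) * card (words b)"
proof -
  have "card (words (a + b)) \<le> card (words a \<times> words b)"
  proof (rule card_inj_on_le[where f = "\<lambda>w. (take a w, drop a w)"])
    show "inj_on (\<lambda>w. (take a w, drop a w)) (words (a + b))"
      by (rule inj_onI) (metis append_take_drop_id prod.inject)
    show "(\<lambda>w. (take a w, drop a w)) ` words (a + b) \<subseteq> words a \<times> words b"
      using take_in drop_in by (auto simp: words_def)
  qed simp
  then show ?thesis by (simp add: card_cartesian_product)
qed

lemma card_words_mult: "card (words (i * n)) \<le> card (words n) ^ i"
proof (induction i)
  case 0
  have "words 0 \<subseteq> {[]}" by (auto simp: words_def)
  then show ?case using card_mono[of "{[]}" "words 0"] by simp
next
  case (Suc i)
  have "card (words (n + i * n)) \<le> card (words n) * card (words n) ^ i"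
    using card_words_add[of n "i * n"] Suc by (meson le_trans mult_le_mono2)
  then show ?case by simp
qed

section \<open>Paths and cycles in the graph of blocks\<close>

definition edge :: "nat \<Rightarrow> ('k list \<times> 'k list) set" where
  "edge m = {(u, v). u \<in> words m \<and> v \<in> words m \<and> u @ v \<in> L}"

definition block :: "nat \<Rightarrow> 'k list \<Rightarrow> nat \<Rightarrow> 'k list" where
  "block m w i = take m (drop (i * m) w)"

lemma block_words:
  assumes "w \<in> words (s * m)" "i < s"
  shows "block m w i \<in> words m"
proof -
  have "Suc i * m \<le> s * m" using assms(2) by (intro mult_le_mono1) simp
  then show ?thesis
    using assms factor_take_drop[of w m "i * m"] by (auto simp: words_def block_def)
qed

lemma block_edge:
  assumes "w \<in> words (s * m)" "Suc i < s"
  shows "(block m w i, block m w (Suc i)) \<in> edge m"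
proof -
  have "block m w i @ block m w (Suc i) = take (m + m) (drop (i * m) w)"
    by (simp add: block_def take_add add.commute)
  then have "block m w i @ block m w (Suc i) \<in> L"
    using assms factor_take_drop[of w "m + m" "i * m"] by (auto simp: words_def)
  then show ?thesis using assms block_words[of w s m] by (simp add: edge_def)
qed

lemma block_path:
  assumes "w \<in> words (s * m)" "i \<le> j" "j < s"
  shows "(block m w i, block m w j) \<in> edge m ^^ (j - i)"
  using assms(2,3)
proof (induction rule: dec_induct)
  case (step n)
  then have "(block m w i, block m w (Suc n)) \<in> edge m ^^ Suc (n - i)"
    using block_edge[OF assms(1), of n] by auto
  then show ?case using step by (simp add: Suc_diff_le)
qed simp

lemma block_determine:
  assumes "w \<in> words (s * m)" "w' \<in> words (s * m)" "\<And>i. i < s \<Longrightarrow> block m w i = block m w' i"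
  shows "w = w'"
proof -
  have "take (j * m) w = take (j * m) w'" if "j \<le> s" for j
    using that
  proof (induction j)
    case (Suc j)
    have "take (j * m + m) v = take (j * m) v @ block m v j" for v :: "'k list"
      by (simp add: take_add block_def)
    then show ?case using Suc assms(3)[of j] by (simp add: add.commute)
  qed simp
  from this[of s] show ?thesis using assms(1,2) by (simp add: words_def)
qed

text \<open>Bressaud and Quas: without short cycles a path is determined by its set of vertices, because
  two paths visiting the same vertices in different orders contain a cycle.\<close>

lemma short_cycle:
  assumes large: "card (words m) choose s < card (words (s * m))"
  obtains u t where "(u, u) \<in> edge m ^^ t" "1 \<le> t" "t \<le> 2 * s"
proof (rule ccontr)
  assume "\<not> thesis"
  with that have no_cycle: "(u, u) \<notin> edge m ^^ t" if "1 \<le> t" "t \<le> 2 * s" for u t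
    using that by blast
  \<comment> \<open>A block repeated inside one word would close a cycle of length below
    \<open>s\<close>.\<close>
  have inj: "inj_on (block m w) {..<s}" if w: "w \<in> words (s * m)" for w
  proof (rule linorder_inj_onI)
    fix i j assume "i < j" "i \<in> {..<s}" "j \<in> {..<s}"
    then show "block m w i \<noteq> block m w j"
      using block_path[OF w, of i j] no_cycle[of "j - i" "block m w i"]
      by (metis Suc_leI diff_le_self le_trans lessThan_iff less_imp_le mult_2 One_nat_def
          trans_le_add1 zero_less_diff)
  qed auto
  have "card (words (s * m)) \<le> card {B. B \<subseteq> words m \<and> card B = s}"
  proof (rule card_inj_on_le[where f = "\<lambda>w. block m w ` {..<s}"])
    show "(\<lambda>w. block m w ` {..<s}) ` words (s * m) \<subseteq> {B. B \<subseteq> words m \<and> card B = s}"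
      using block_words inj by (auto simp: card_image)
    show "inj_on (\<lambda>w. block m w ` {..<s}) (words (s * m))"
    proof (rule inj_onI, rule ccontr)
      fix w w' assume w: "w \<in> words (s * m)" and w': "w' \<in> words (s * m)"
        and eq: "block m w ` {..<s} = block m w' ` {..<s}" and "w \<noteq> w'"
      \<comment> \<open>At the first disagreement, injectivity and equality of the vertex sets force
        each word to visit the \<open>i\<close>-th block of the other one strictly later. This gives
        paths both ways between the two blocks, of total length at most
        \<open>2 * s\<close>.\<close>
      define i where "i = (LEAST i. i < s \<and> block m w i \<noteq> block m w' i)"
      have "\<exists>i. i < s \<and> block m w i \<noteq> block m w' i"
        using block_determine[OF w w'] \<open>w \<noteq> w'\<close> by blast
      then have i: "i < s" "block m w i \<noteq> block m w' i"
        unfolding i_def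
        using LeastI_ex[of "\<lambda>i. i < s \<and> block m w i \<noteq> block m w' i"] by blast+
      have before: "block m w j = block m w' j" if "j < i" for j
        using not_less_Least[of j "\<lambda>i. i < s \<and> block m w i \<noteq> block m w' i"] that i(1)
        by (auto simp: i_def)
      obtain j where j: "j < s" "block m w' i = block m w j"
        using eq i(1) by (metis (no_types, lifting) image_iff lessThan_iff)
      obtain j' where j': "j' < s" "block m w i = block m w' j'"
        using eq i(1) by (metis (no_types, lifting) image_iff lessThan_iff)
      have "i < j"
      proof (rule ccontr)
        assume "\<not> i < j"
        then have "j < i" using i j by (metis linorder_neqE_nat)
        then show False
          using before[of j] inj_onD[OF inj[OF w'], of j i] i(1) j by auto
      qed
      have "i < j'"
      proof (rule ccontr)
        assume "\<not> i < j'"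
        then have "j' < i" using i j' by (metis linorder_neqE_nat)
        then show False
          using before[of j'] inj_onD[OF inj[OF w], of j' i] i(1) j' by auto
      qed
      have "(block m w i, block m w' i) \<in> edge m ^^ (j - i)"
        using block_path[OF w, of i j] \<open>i < j\<close> j by simp
      moreover have "(block m w' i, block m w i) \<in> edge m ^^ (j' - i)"
        using block_path[OF w', of i j'] \<open>i < j'\<close> j' by simp
      ultimately have "(block m w i, block m w i) \<in> edge m ^^ ((j - i) + (j' - i))"
        by (auto simp: relpow_add)
      moreover have "1 \<le> (j - i) + (j' - i)" "(j - i) + (j' - i) \<le> 2 * s"
        using \<open>i < j\<close> j(1) j'(1) by auto
      ultimately show False using no_cycle by blast
    qed
    show "finite {B. B \<subseteq> words m \<and> card B = s}" by simp
  qed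
  then show False using large by (simp add: n_subsets)
qed

text \<open>Each window of length \<open>m\<close> of the periodic concatenation lies within two
  consecutive blocks, whose concatenation is in \<open>L\<close> by the definition of
  \<open>edge\<close>; so the window is in \<open>L\<close> as a factor. Longer windows are not
  controlled.\<close>

lemma cycle_periodic_point:
  assumes cyc: "(u, u) \<in> edge m ^^ t" and t: "1 \<le> t" and m: "1 \<le> m"
  obtains x where "(shift ^^ (t * m)) x = x" "\<And>i. map (\<lambda>j. x (i + j)) [0..<m] \<in> L"
proof -
  obtain g where g: "g 0 = u" "g t = u" "\<And>i. i < t \<Longrightarrow> (g i, g (Suc i)) \<in> edge m"
    using cyc by (auto simp: relpow_fun_conv)
  define b where "b i = g (i mod t)" for i
  have b: "(b i, b (Suc i)) \<in> edge m" for i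
  proof (cases "Suc (i mod t) = t")
    case True
    then show ?thesis using g(3)[of "i mod t"] t by (simp add: b_def mod_Suc g(1,2))
  next
    case False
    then show ?thesis using g(3)[of "i mod t"] t by (simp add: b_def mod_Suc)
  qed
  then have len: "length (b i) = m" for i by (auto simp: edge_def words_def)
  define x where "x i = b (i div m) ! (i mod m)" for i
  show ?thesis
  proof
    have "x (t * m + i) = x i" for i
      using m by (simp add: x_def b_def)
    then show "(shift ^^ (t * m)) x = x" by (simp add: fun_eq_iff funpow_shift)
    show "map (\<lambda>j. x (i + j)) [0..<m] \<in> L" for i
    proof -
      let ?w = "b (i div m) @ b (Suc (i div m))"
      have "?w \<in> L" using b[of "i div m"] by (simp add: edge_def)
      moreover have "map (\<lambda>j. x (i + j)) [0..<m] = take m (drop (i mod m) ?w)"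
      proof (rule nth_equalityI)
        have im: "i mod m < m" using m by simp
        then show "length (map (\<lambda>j. x (i + j)) [0..<m]) = length (take m (drop (i mod m) ?w))"
          by (simp add: len)
        fix j assume "j < length (map (\<lambda>j. x (i + j)) [0..<m])"
        then have j: "j < m" by simp
        have euclid: "(m * a + r) div m = a" "(m * a + r) mod m = r" if "r < m" for a r
          using that by simp_all
        have ij: "i + j = m * (i div m) + (i mod m + j)" by simp
        have nth: "take m (drop (i mod m) ?w) ! j = ?w ! (i mod m + j)"
        proof -
          have "i mod m \<le> length ?w" unfolding length_append len using im by linarith
          then show ?thesis using j by (simp add: nth_drop del: drop_append)
        qed
        show "map (\<lambda>j. x (i + j)) [0..<m] ! j = take m (drop (i mod m) ?w) ! j"
        proof (cases "i mod m + j < m")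
          case True
          have "(i + j) div m = i div m" "(i + j) mod m = i mod m + j"
            unfolding ij using euclid[OF True, of "i div m"] by simp_all
          then have "x (i + j) = b (i div m) ! (i mod m + j)" by (simp only: x_def)
          moreover have "?w ! (i mod m + j) = b (i div m) ! (i mod m + j)"
            using True by (simp only: nth_append len if_True)
          ultimately show ?thesis unfolding nth using j by simp
        next
          case False
          define r where "r = i mod m + j - m"
          have r: "r < m" "i mod m + j = m + r" unfolding r_def using False im j by linarith+
          have "i + j = m * Suc (i div m) + r" using ij r(2) by simp
          then have "(i + j) div m = Suc (i div m)" "(i + j) mod m = r"
            using euclid[OF r(1), of "Suc (i div m)"] by metis+
          then have "x (i + j) = b (Suc (i div m)) ! r" by (simp only: x_def)
          moreover have "?w ! (i mod m + j) = b (Suc (i div m)) ! r"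
            unfolding r(2) nth_append len by simp
          ultimately show ?thesis unfolding nth using j by simp
        qed
      qed
      ultimately show ?thesis using factor_take_drop by metis
    qed
  qed
qed

end

lemma exp_power: "exp x ^ n = exp (real n * (x::real))"
  by (simp add: exp_of_nat_mult)

text \<open>The term \<open>s ^ s / fact s\<close> of the series for \<open>exp s\<close> is at most
  the whole series.\<close>

lemma fact_ge: "(real s / exp 1) ^ s \<le> fact s"
proof -
  have "real s ^ s / fact s \<le> exp (real s)"
  proof -
    have "summable (\<lambda>n. inverse (fact n) * real s ^ n)" by (rule summable_exp)
    then have "(\<Sum>n\<in>{s}. inverse (fact n) * real s ^ n) \<le> (\<Sum>n. inverse (fact n) * real s ^ n)"
      by (intro sum_le_suminf) auto
    then show ?thesis by (simp add: exp_def divide_inverse scaleR_conv_of_real mult.commute)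
  qed
  then show ?thesis by (simp add: power_divide field_simps exp_power)
qed

lemma binomial_le_power_fact: "real (n choose s) \<le> real n ^ s / fact s"
proof -
  have "(n choose s) * fact s \<le> n ^ s"
  proof (cases "s \<le> n")
    case True
    have "fact n div fact (n - s) = (n choose s) * fact s"
      using binomial_fact_lemma[OF True] fact_nonzero[of "n - s", where ?'a = nat]
      by (metis mult.assoc mult.commute nonzero_mult_div_cancel_left)
    then show ?thesis using fact_div_fact_le_pow[OF True] by simp
  qed (simp add: binomial_eq_0)
  then have "real ((n choose s) * fact s) \<le> real (n ^ s)" by (rule of_nat_mono)
  then show ?thesis by (simp add: field_simps)
qed

context factorial_language
begin

text \<open>\<open>h\<close> is the entropy of the language, taken as the infimum of
  \<open>ln (card (words n)) / n\<close>. Being an infimum, it bounds all lengths from below; from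
  above, submultiplicativity carries the estimate at a nearly optimal length \<open>n0\<close> only
  to multiples of \<open>n0\<close>. This is why later windows have length
  \<open>i * n0\<close>.\<close>

lemma low_growth:
  assumes "0 < \<epsilon>"
  obtains h n0 where "1 \<le> n0" "\<And>n. exp (h * real n) \<le> real (card (words n))"
    "\<And>i. real (card (words (i * n0))) \<le> exp ((h + \<epsilon>) * real (i * n0))"
proof -
  define r where "r n = ln (real (card (words n))) / real n" for n
  define h where "h = (INF n\<in>{1..}. r n)"
  have c: "1 \<le> real (card (words n))" for n using card_words_pos[of n] by linarith
  have bdd: "bdd_below (r ` {1..})"
    using c by (intro bdd_belowI2[of _ 0]) (auto simp: r_def)
  have h_le: "h \<le> r n" if "1 \<le> n" for n
    unfolding h_def using that by (intro cINF_lower bdd) auto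
  have "\<exists>n\<in>{1..}. r n < h + \<epsilon>"
    using cINF_less_iff[OF _ bdd, of "h + \<epsilon>"] assms by (auto simp: h_def)
  then obtain n0 where n0: "1 \<le> n0" "r n0 < h + \<epsilon>" by auto
  show ?thesis
  proof
    show "1 \<le> n0" by fact
    show "exp (h * real n) \<le> real (card (words n))" for n
    proof (cases "n = 0")
      case False
      then have "h * real n \<le> ln (real (card (words n)))"
        using h_le[of n] by (simp add: r_def le_divide_eq)
      then show ?thesis using c[of n] by (metis exp_le_cancel_iff exp_ln less_le_trans zero_less_one)
    qed (use c[of 0] in simp)
    show "real (card (words (i * n0))) \<le> exp ((h + \<epsilon>) * real (i * n0))" for i
    proof -
      have "ln (real (card (words n0))) \<le> (h + \<epsilon>) * real n0"
        using n0 by (simp add: r_def divide_less_eq)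
      then have "real (card (words n0)) \<le> exp ((h + \<epsilon>) * real n0)"
        using c[of n0] by (metis exp_le_cancel_iff exp_ln less_le_trans zero_less_one)
      then have "real (card (words n0)) ^ i \<le> exp ((h + \<epsilon>) * real n0) ^ i"
        by (intro power_mono) auto
      moreover have "real (card (words (i * n0))) \<le> real (card (words n0)) ^ i"
        using card_words_mult[of i n0] by (metis of_nat_le_iff of_nat_power)
      ultimately have "real (card (words (i * n0))) \<le> exp ((h + \<epsilon>) * real n0) ^ i"
        by linarith
      then show ?thesis by (simp add: exp_power mult_ac)
    qed
  qed
qed

lemma short_periodic_point:
  assumes "0 < \<epsilon>"
  obtains n0 where "1 \<le> n0"
    "\<And>i. 1 \<le> i \<Longrightarrow> \<exists>p x. 1 \<le> p \<and> real p \<le> 14 * real (i * n0) * exp (\<epsilon> * real (i * n0)) \<and>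
       (shift ^^ p) x = x \<and> (\<forall>l. map (\<lambda>j. x (l + j)) [0..<i * n0] \<in> L)"
proof -
  obtain h n0 where n0: "1 \<le> n0" and lower: "\<And>n. exp (h * real n) \<le> real (card (words n))"
    and upper: "\<And>i. real (card (words (i * n0))) \<le> exp ((h + \<epsilon>) * real (i * n0))"
    using low_growth[OF assms] by metis
  show ?thesis
  proof
    show "1 \<le> n0" by fact
    fix i :: nat assume i: "1 \<le> i"
    define m where "m = i * n0"
    have m: "1 \<le> m" using i n0 by (simp add: m_def)
    define E where "E = exp (\<epsilon> * real m)"
    have E: "1 \<le> E" using assms by (simp add: E_def)
    \<comment> \<open>Just large enough for \<open>exp 1 * E / s < 1\<close>: by
      \<open>fact_ge\<close> the sets of \<open>s\<close> blocks are then outnumbered by the words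
      of length \<open>s * m\<close>, whatever \<open>h\<close> is.\<close>
    define s where "s = Suc (nat \<lfloor>exp 1 * E\<rfloor>)"
    have s_gt: "exp 1 * E < real s" unfolding s_def by linarith
    have s_le: "real s \<le> exp 1 * E + 1" unfolding s_def using E by simp
    have s: "0 < s" by (simp add: s_def)
    have "real (card (words m) choose s) \<le> real (card (words m)) ^ s / fact s"
      by (rule binomial_le_power_fact)
    also have "\<dots> \<le> exp ((h + \<epsilon>) * real m) ^ s / (real s / exp 1) ^ s"
      using upper[of i] fact_ge[of s] s by (intro frac_le power_mono) (auto simp: m_def)
    also have "\<dots> = exp (h * real m) ^ s * (exp 1 * E / real s) ^ s"
      by (simp add: E_def exp_add distrib_right power_mult_distrib power_divide)
    also have "\<dots> < exp (h * real m) ^ s * 1"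
    proof (intro mult_strict_left_mono)
      show "(exp 1 * E / real s) ^ s < 1"
        using s_gt s E by (intro power_less_one_iff[THEN iffD2]) auto
    qed simp
    also have "\<dots> \<le> real (card (words (s * m)))"
      using lower[of "s * m"] by (simp add: exp_power mult_ac)
    finally have "card (words m) choose s < card (words (s * m))" by simp
    then obtain u t where t: "(u, u) \<in> edge m ^^ t" "1 \<le> t" "t \<le> 2 * s" by (rule short_cycle)
    obtain x where x: "(shift ^^ (t * m)) x = x" "\<And>l. map (\<lambda>j. x (l + j)) [0..<m] \<in> L"
      using cycle_periodic_point[OF t(1,2) m] by blast
    have "exp 1 \<le> (3::real)" by (rule exp_le)
    then have "exp 1 * E \<le> 3 * E" using E by (intro mult_right_mono) auto
    \<comment> \<open>From \<open>t \<le> 2 * (3 * E + 1)\<close> and \<open>1 \<le> E\<close>; the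
      constant is generous, 8 would do.\<close>
    then have "real t \<le> 14 * E" using t(3) s_le E by linarith
    then have "real (t * m) \<le> 14 * real m * E"
      using mult_right_mono[of "real t" "14 * E" "real m"] by (simp add: mult_ac)
    moreover have "1 \<le> t * m" using t m by simp
    ultimately show "\<exists>p x. 1 \<le> p \<and> real p \<le> 14 * real (i * n0) * exp (\<epsilon> * real (i * n0)) \<and>
       (shift ^^ p) x = x \<and> (\<forall>l. map (\<lambda>j. x (l + j)) [0..<i * n0] \<in> L)"
      using x unfolding m_def E_def by blast
  qed
qed

text \<open>The period is subexponential in the window length \<open>m\<close>, whatever the entropy of \<open>L\<close>.\<close>

lemma superpolynomial_approximation:
  assumes th: "0 < \<theta>" "\<theta> < 1" and "0 < \<delta>"
  obtains m p x where "1 \<le> m" "1 \<le> p" "real p ^ N * \<theta> ^ m < \<delta>" "(shift ^^ p) x = x"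
    "\<And>l. map (\<lambda>j. x (l + j)) [0..<m] \<in> L"
proof -
  \<comment> \<open>With this rate \<open>real p ^ N\<close> grows at most like
    \<open>exp (- ln \<theta> / 2 * m)\<close>, which uses up half of the decay of
    \<open>\<theta> ^ m\<close>; the other half is the factor \<open>q ^ m\<close> below. The
    polynomial factor \<open>m\<close> in the period is absorbed by doubling
    \<open>\<epsilon>\<close>.\<close>
  define \<epsilon> where "\<epsilon> = - ln \<theta> / (4 * (real N + 1))"
  have ln_th: "ln \<theta> < 0" using th by simp
  have eps: "0 < \<epsilon>" using ln_th by (simp add: \<epsilon>_def divide_neg_pos)
  obtain n0 where n0: "1 \<le> n0" and point:
    "\<And>i. 1 \<le> i \<Longrightarrow> \<exists>p x. 1 \<le> p \<and> real p \<le> 14 * real (i * n0) * exp (\<epsilon> * real (i * n0)) \<and>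
       (shift ^^ p) x = x \<and> (\<forall>l. map (\<lambda>j. x (l + j)) [0..<i * n0] \<in> L)"
    using short_periodic_point[OF eps] by metis
  define D where "D = (14 / \<epsilon>) ^ N"
  have D: "0 < D" using eps by (simp add: D_def)
  define q where "q = exp (ln \<theta> / 2)"
  have q: "0 < q" "q < 1" using ln_th by (auto simp: q_def)
  have "(\<lambda>i. q ^ i) \<longlonglongrightarrow> 0" using q by (intro LIMSEQ_realpow_zero) auto
  then have "\<forall>\<^sub>F i in sequentially. q ^ i < \<delta> / D"
    using D assms(3) by (intro order_tendstoD) auto
  then obtain i0 where i0: "\<And>i. i0 \<le> i \<Longrightarrow> q ^ i < \<delta> / D"
    by (auto simp: eventually_sequentially)
  define i where "i = Suc i0"
  define m where "m = i * n0"
  have "i \<le> m" using n0 by (simp add: m_def)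
  obtain p x where p: "1 \<le> p" "real p \<le> 14 * real m * exp (\<epsilon> * real m)" "(shift ^^ p) x = x"
    "\<forall>l. map (\<lambda>j. x (l + j)) [0..<m] \<in> L"
    using point[of i] by (auto simp: m_def i_def)
  have "\<epsilon> * real m \<le> exp (\<epsilon> * real m)"
    using exp_ge_add_one_self[of "\<epsilon> * real m"] by linarith
  then have "real m \<le> exp (\<epsilon> * real m) / \<epsilon>" using eps by (simp add: field_simps)
  then have "14 * real m * exp (\<epsilon> * real m) \<le> 14 * (exp (\<epsilon> * real m) / \<epsilon>) * exp (\<epsilon> * real m)"
    by (intro mult_right_mono mult_left_mono) auto
  also have "\<dots> = 14 / \<epsilon> * exp (2 * \<epsilon> * real m)"
    by (simp add: mult_exp_exp)
  finally have "real p \<le> 14 / \<epsilon> * exp (2 * \<epsilon> * real m)" using p(2) by linarith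
  then have "real p ^ N \<le> (14 / \<epsilon> * exp (2 * \<epsilon> * real m)) ^ N" by (intro power_mono) auto
  also have "\<dots> = D * exp (real N * (2 * \<epsilon> * real m))"
    by (simp only: D_def power_mult_distrib exp_power)
  also have "\<dots> \<le> D * exp (real m * (- ln \<theta> / 2))"
  proof -
    have "2 * \<epsilon> * real N \<le> - ln \<theta> / 2"
    proof -
      have "2 * \<epsilon> * real N \<le> 2 * \<epsilon> * (real N + 1)" using eps by simp
      also have "\<dots> = - ln \<theta> / 2" by (simp add: \<epsilon>_def field_simps)
      finally show ?thesis .
    qed
    then have "real m * (2 * \<epsilon> * real N) \<le> real m * (- ln \<theta> / 2)" by (intro mult_left_mono) auto
    then show ?thesis using D by (simp add: mult_ac)
  qed
  finally have "real p ^ N * \<theta> ^ m \<le> D * exp (real m * (- ln \<theta> / 2)) * \<theta> ^ m"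
    using th by (intro mult_right_mono) auto
  also have "\<dots> = D * q ^ m"
  proof -
    have "\<theta> ^ m = exp (real m * ln \<theta>)" using th by (simp add: exp_of_nat_mult)
    then show ?thesis by (simp add: q_def exp_power mult_exp_exp)
  qed
  also have "\<dots> < \<delta>"
    using i0[of m] \<open>i \<le> m\<close> D by (simp add: i_def field_simps)
  finally have "real p ^ N * \<theta> ^ m < \<delta>" .
  moreover have "1 \<le> m" using \<open>i \<le> m\<close> by (simp add: i_def)
  ultimately show ?thesis using that[of m p x] p by blast
qed

end

section \<open>Well separated periodic orbits\<close>

context shift_space
begin

text \<open>Quantifying over all points with prefix \<open>w\<close> makes this a property of the
  word alone. The tolerance grows towards the end of the word because from position \<open>j\<close>
  on only \<open>length w - j\<close> symbols are known, which determines \<open>F\<close> up to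
  \<open>K * \<theta> ^ (length w - j)\<close>.\<close>

definition near_zero_words :: "real \<Rightarrow> ((nat \<Rightarrow> 'k) \<Rightarrow> real) \<Rightarrow> 'k list set" where
  "near_zero_words K F = {w. \<forall>x. (\<forall>i<length w. x i = w ! i) \<longrightarrow>
     (\<forall>j<length w. - F ((shift ^^ j) x) \<le> (K + 1) / (1 - \<theta>) * \<theta> ^ (length w - j))}"

lemma slip_agree:
  assumes "slip K f" "0 \<le> K" "\<And>i. i < n \<Longrightarrow> x i = y i"
  shows "f y \<le> f x + K * \<theta> ^ n"
proof -
  have "sd x y \<le> \<theta> ^ n" using assms(3) by (simp add: sd_le_power_iff)
  then have "K * sd x y \<le> K * \<theta> ^ n" using assms(2) by (rule mult_left_mono)
  then show ?thesis using slipD[OF assms(1), of x y] by (simp add: abs_le_iff)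
qed

lemma factorial_near_zero_words:
  fixes F :: "(nat \<Rightarrow> 'k::finite) \<Rightarrow> real"
  assumes K: "0 \<le> K" and F: "slip K F"
    and near: "\<And>n \<eta>. 0 < \<eta> \<Longrightarrow> \<exists>x. \<forall>j<n. - \<eta> \<le> F ((shift ^^ j) x)"
  shows "factorial_language (near_zero_words K F)"
proof
  let ?K = "(K + 1) / (1 - \<theta>)"
  have K1: "K + 1 \<le> ?K" using K theta_pos theta_less by (simp add: field_simps)
  have "?K * (1 - \<theta>) = K + 1" using theta_less by simp
  \<comment> \<open>The reason for the constant \<open>?K\<close>: cutting off a nonempty end
    \<open>w\<close> means that the bound inherited from the longer word is better by a factor
    \<open>\<theta>\<close>, and this leaves room for the error \<open>K\<close> of replacing the
    tail.\<close>
  then have K2: "?K * \<theta> + K \<le> ?K" by (simp only: right_diff_distrib)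
  note mF = slip_uminus[OF F]
  fix u v w :: "'k list" assume uvw: "u @ v @ w \<in> near_zero_words K F"
  let ?w = "u @ v @ w"
  show "v \<in> near_zero_words K F"
    unfolding near_zero_words_def
  proof (intro CollectI allI impI)
    fix x j assume x: "\<forall>i<length v. x i = v ! i" and j: "j < length v"
    \<comment> \<open>A point with prefix \<open>v\<close> is compared with one that has prefix
      \<open>u @ v @ w\<close>. If \<open>w = []\<close> the shifted points coincide and no error
      arises; otherwise \<open>K2\<close> absorbs it.\<close>
    define x' where "x' i = (if i < length ?w then ?w ! i else x (i - length u))" for i
    let ?j = "length u + j"
    have "\<forall>i<length ?w. x' i = ?w ! i" by (simp add: x'_def)
    moreover have "?j < length ?w" using j by simp
    ultimately have "- F ((shift ^^ ?j) x') \<le> ?K * \<theta> ^ (length ?w - ?j)"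
      using uvw unfolding near_zero_words_def by blast
    then have x': "- F ((shift ^^ ?j) x') \<le> ?K * \<theta> ^ (length v - j + length w)"
      using j by simp
    show "- F ((shift ^^ j) x) \<le> ?K * \<theta> ^ (length v - j)"
    proof (cases "w = []")
      case True
      then have "(shift ^^ ?j) x' = (shift ^^ j) x"
        using x by (auto simp: fun_eq_iff funpow_shift x'_def nth_append)
      then show ?thesis using x' True by simp
    next
      case False
      have "(shift ^^ ?j) x' i = (shift ^^ j) x i" if "i < length v - j" for i
      proof -
        have "j + i < length v" using that by simp
        then show ?thesis using x by (simp add: funpow_shift x'_def nth_append)
      qed
      then have "- F ((shift ^^ j) x) \<le> - F ((shift ^^ ?j) x') + K * \<theta> ^ (length v - j)"
        by (intro slip_agree[OF mF K])
      also have "\<dots> \<le> ?K * \<theta> ^ Suc (length v - j) + K * \<theta> ^ (length v - j)"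
      proof -
        have "\<theta> ^ (length v - j + length w) \<le> \<theta> ^ Suc (length v - j)"
          using False theta_pos theta_less
          by (intro power_decreasing) (auto simp: Suc_le_eq)
        then have "?K * \<theta> ^ (length v - j + length w) \<le> ?K * \<theta> ^ Suc (length v - j)"
          using K1 K by (intro mult_left_mono) auto
        then show ?thesis using x' by linarith
      qed
      also have "\<dots> = (?K * \<theta> + K) * \<theta> ^ (length v - j)" by (simp add: algebra_simps)
      also have "\<dots> \<le> ?K * \<theta> ^ (length v - j)"
        using K2 theta_pos by (intro mult_right_mono) auto
      finally show ?thesis .
    qed
  qed
next
  let ?K = "(K + 1) / (1 - \<theta>)"
  have K1: "K + 1 \<le> ?K" using K theta_pos theta_less by (simp add: field_simps)
  note mF = slip_uminus[OF F]
  fix n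
  obtain x where x: "\<forall>j<n. - (\<theta> ^ n) \<le> F ((shift ^^ j) x)"
    using near[of "\<theta> ^ n" n] theta_pos by auto
  have "map x [0..<n] \<in> near_zero_words K F"
    unfolding near_zero_words_def
  proof (intro CollectI allI impI)
    fix y j assume y: "\<forall>i<length (map x [0..<n]). y i = map x [0..<n] ! i"
      and "j < length (map x [0..<n])"
    then have j: "j < n" by simp
    have "(shift ^^ j) x i = (shift ^^ j) y i" if "i < n - j" for i
      using that y by (simp add: funpow_shift)
    then have "- F ((shift ^^ j) y) \<le> - F ((shift ^^ j) x) + K * \<theta> ^ (n - j)"
      by (intro slip_agree[OF mF K])
    also have "- F ((shift ^^ j) x) \<le> \<theta> ^ n" using x j by (metis minus_le_iff)
    also have "\<theta> ^ n \<le> \<theta> ^ (n - j)"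
      using theta_pos theta_less by (intro power_decreasing) auto
    also have "\<theta> ^ (n - j) + K * \<theta> ^ (n - j) = (K + 1) * \<theta> ^ (n - j)"
      by (simp add: algebra_simps)
    also have "\<dots> \<le> ?K * \<theta> ^ (n - j)"
      using K1 theta_pos by (intro mult_right_mono) auto
    finally show "- F ((shift ^^ j) y) \<le> ?K * \<theta> ^ (length (map x [0..<n]) - j)" by simp
  qed
  then show "\<exists>w\<in>near_zero_words K F. length w = n" by force
qed

lemma superpolynomial_periodic:
  fixes F :: "(nat \<Rightarrow> 'k::finite) \<Rightarrow> real"
  assumes K: "0 \<le> K" and F: "slip K F"
    and near: "\<And>n \<eta>. 0 < \<eta> \<Longrightarrow> \<exists>x. \<forall>j<n. - \<eta> \<le> F ((shift ^^ j) x)"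
    and "0 < \<delta>"
  obtains p x where "1 \<le> p" "(shift ^^ p) x = x" "real p ^ N * - birkhoff F p x < \<delta>"
proof -
  interpret factorial_language "near_zero_words K F"
    by (rule factorial_near_zero_words[OF K F near])
  let ?K = "(K + 1) / (1 - \<theta>)"
  have K': "0 < ?K" using K theta_less by simp
  \<comment> \<open>The exponent is \<open>Suc N\<close> because one more factor \<open>p\<close>
    pays for summing over a period.\<close>
  obtain m p x where m: "1 \<le> m" and p: "1 \<le> p" "real p ^ Suc N * \<theta> ^ m < \<delta> / ?K"
    "(shift ^^ p) x = x" and w: "\<And>l. map (\<lambda>j. x (l + j)) [0..<m] \<in> near_zero_words K F"
    using superpolynomial_approximation[OF theta_pos theta_less, of "\<delta> / ?K" "Suc N"] assms(4) K'
    by (metis divide_pos_pos)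
  have "- F ((shift ^^ l) x) \<le> ?K * \<theta> ^ m" for l
  proof -
    let ?w = "map (\<lambda>j. x (l + j)) [0..<m]"
    have "\<forall>i<length ?w. (shift ^^ l) x i = ?w ! i" by (simp add: funpow_shift)
    moreover have "0 < length ?w" using m by simp
    ultimately have "- F ((shift ^^ 0) ((shift ^^ l) x)) \<le> ?K * \<theta> ^ (length ?w - 0)"
      using w[of l] unfolding near_zero_words_def by blast
    then show ?thesis by simp
  qed
  then have "(\<Sum>l<p. - F ((shift ^^ l) x)) \<le> of_nat (card {..<p}) * (?K * \<theta> ^ m)"
    by (intro sum_bounded_above)
  then have "- birkhoff F p x \<le> real p * (?K * \<theta> ^ m)"
    by (simp add: birkhoff_def sum_negf)
  then have "real p ^ N * - birkhoff F p x \<le> real p ^ N * (real p * (?K * \<theta> ^ m))"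
    by (rule mult_left_mono) simp
  also have "\<dots> = ?K * (real p ^ Suc N * \<theta> ^ m)" by simp
  also have "\<dots> < ?K * (\<delta> / ?K)" using p(2) K' by (intro mult_strict_left_mono)
  also have "\<dots> = \<delta>" using K' by (metis less_irrefl mult.commute nonzero_eq_divide_eq)
  finally show ?thesis using that p by blast
qed

text \<open>The first \<open>l\<close> symbols of \<open>x\<close> are repeated. If \<open>d\<close>
  is the distance of \<open>x\<close> to its return and \<open>e\<close> that of the return to the
  new point, then \<open>e \<le> d + \<theta> * e\<close>, so
  \<open>e \<le> d / (1 - \<theta>)\<close>; shadowing gives the second factor
  \<open>1 / (1 - \<theta>)\<close>.\<close>

lemma close_loop:
  fixes F :: "(nat \<Rightarrow> 'k) \<Rightarrow> real"
  assumes K: "0 \<le> K" and F: "slip K F" and "1 \<le> l"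
  obtains y where "(shift ^^ l) y = y"
    "- birkhoff F l y \<le> - birkhoff F l x + K / (1 - \<theta>)\<^sup>2 * sd x ((shift ^^ l) x)"
proof
  let ?y = "\<lambda>i. x (i mod l)"
  let ?d = "sd x ((shift ^^ l) x)" and ?e = "sd ((shift ^^ l) x) ?y"
  show y: "(shift ^^ l) ?y = ?y" by (rule periodic_extension[OF assms(3)])
  have "sd x ?y = \<theta> ^ l * ?e"
    using sd_funpow_shift[of l x ?y] y by simp
  also have "\<dots> \<le> \<theta> * ?e"
    using assms(3) theta_pos theta_less power_decreasing[of 1 l \<theta>] by (intro mult_right_mono) auto
  finally have "?e \<le> ?d + \<theta> * ?e"
    using sd_triangle[of "(shift ^^ l) x" ?y x] sd_commute[of x "(shift ^^ l) x"] by simp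
  then have e: "?e \<le> ?d / (1 - \<theta>)" using theta_less by (simp add: field_simps)
  have "\<bar>birkhoff F l x - birkhoff F l ?y\<bar> \<le> K / (1 - \<theta>) * ?e"
    using birkhoff_shadow[OF F K, of l x ?y] y by simp
  also have "\<dots> \<le> K / (1 - \<theta>) * (?d / (1 - \<theta>))"
    using e K theta_less by (intro mult_left_mono) auto
  finally show "- birkhoff F l ?y \<le> - birkhoff F l x + K / (1 - \<theta>)\<^sup>2 * ?d"
    by (simp add: power2_eq_square)
qed

lemma birkhoff_nonpos: "(\<And>x. F x \<le> 0) \<Longrightarrow> birkhoff F n x \<le> 0"
  by (simp add: birkhoff_def sum_nonpos)

text \<open>Two points of the orbit cut it into two loops with the same closing distance. The
  shorter one has length at most \<open>p / 2\<close>, and since \<open>F\<close> is nonpositive its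
  loss is at most that of the whole orbit.\<close>

lemma split_periodic:
  fixes F :: "(nat \<Rightarrow> 'k) \<Rightarrow> real"
  assumes K: "0 \<le> K" and F: "slip K F" and F0: "\<And>x. F x \<le> 0"
    and x: "(shift ^^ p) x = x" and ab: "a < b" "b < p"
  obtains l y where "1 \<le> l" "2 * l \<le> p" "(shift ^^ l) y = y"
    "- birkhoff F l y
      \<le> - birkhoff F p x + K / (1 - \<theta>)\<^sup>2 * sd ((shift ^^ a) x) ((shift ^^ b) x)"
proof -
  let ?d = "sd ((shift ^^ a) x) ((shift ^^ b) x)"
  obtain c l where l: "1 \<le> l" "2 * l \<le> p"
    and d: "sd ((shift ^^ c) x) ((shift ^^ l) ((shift ^^ c) x)) = ?d"
  proof (cases "2 * (b - a) \<le> p")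
    case True
    then show ?thesis using that[of "b - a" a] ab by (simp flip: funpow_shift_add)
  next
    case False
    have "(shift ^^ (p - (b - a))) ((shift ^^ b) x) = (shift ^^ (p + a)) x"
      using ab by (simp flip: funpow_shift_add add: add.commute)
    also have "\<dots> = (shift ^^ a) x" using x by (simp add: funpow_shift_add)
    finally show ?thesis
      using that[of "p - (b - a)" b] False ab by (simp add: sd_commute)
  qed
  obtain y where y: "(shift ^^ l) y = y"
    "- birkhoff F l y \<le> - birkhoff F l ((shift ^^ c) x) + K / (1 - \<theta>)\<^sup>2 * ?d"
    using close_loop[OF K F l(1), of "(shift ^^ c) x"] unfolding d by blast
  have "birkhoff F p ((shift ^^ c) x) \<le> birkhoff F l ((shift ^^ c) x)"
    using birkhoff_add[of F l "p - l" "(shift ^^ c) x"] birkhoff_nonpos[of F "p - l", OF F0] l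
    by simp
  then show ?thesis
    using that[OF l y(1)] y(2) birkhoff_cyclic[OF x, of F c] by simp
qed

text \<open>Were there no such orbit, splitting at the closest pair of points would at least halve the
  period while multiplying \<open>- birkhoff F p x\<close> by at most a constant; descending to period one
  bounds \<open>real p ^ N * - birkhoff F p x\<close> below for a suitable \<open>N\<close>.\<close>

lemma separated_periodic:
  fixes F :: "(nat \<Rightarrow> 'k::finite) \<Rightarrow> real"
  assumes K: "0 \<le> K" and F: "slip K F" and F0: "\<And>x. F x \<le> 0"
    and near: "\<And>n \<eta>. 0 < \<eta> \<Longrightarrow> \<exists>x. \<forall>j<n. - \<eta> \<le> F ((shift ^^ j) x)"
    and \<delta>: "0 < \<delta>"
  obtains p s q where "1 \<le> p" "(shift ^^ p) q = q"
    "\<And>a b. a < b \<Longrightarrow> b < p \<Longrightarrow> \<theta> ^ s \<le> sd ((shift ^^ a) q) ((shift ^^ b) q)"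
    "- birkhoff F p q \<le> \<delta> * \<theta> ^ s"
proof (rule ccontr)
  assume "\<not> thesis"
  with that have none: "\<not> (1 \<le> p \<and> (shift ^^ p) q = q \<and>
      (\<forall>a b. a < b \<longrightarrow> b < p \<longrightarrow> \<theta> ^ s \<le> sd ((shift ^^ a) q) ((shift ^^ b) q)) \<and>
      - birkhoff F p q \<le> \<delta> * \<theta> ^ s)" for p s q
    by blast
  \<comment> \<open>The growth of the loss \<open>W\<close> when splitting at a pair of distance at
    most \<open>W / \<delta>\<close>. \<open>N\<close> is taken so large that halving the period
    outweighs it, so \<open>real p ^ N * W\<close> does not increase along the descent.\<close>
  define \<kappa> where "\<kappa> = 1 + K / (1 - \<theta>)\<^sup>2 / \<delta>"
  obtain N where N: "\<kappa> < 2 ^ N" using real_arch_pow[of 2 \<kappa>] by auto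
  have \<kappa>: "0 \<le> \<kappa>" using K \<delta> by (simp add: \<kappa>_def)
  have lower: "\<delta> \<le> real p ^ N * - birkhoff F p x" if "1 \<le> p" "(shift ^^ p) x = x" for p x
    using that
  proof (induction p arbitrary: x rule: less_induct)
    case (less p)
    define W where "W = - birkhoff F p x"
    have W0: "0 \<le> W" using birkhoff_nonpos[of F p x, OF F0] by (simp add: W_def)
    show ?case
    proof (cases "W \<le> \<delta>")
      case False
      have "1 * W \<le> real p ^ N * W" using less.prems(1) W0 by (intro mult_right_mono) auto
      then show ?thesis using False by (simp add: W_def)
    next
      case True
      define S where
        "S = (\<lambda>(a, b). sd ((shift ^^ a) x) ((shift ^^ b) x)) ` {(a, b). a < b \<and> b < p}"
      have "finite {(a, b). a < b \<and> b < p}"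
        by (rule finite_subset[of _ "{..<p} \<times> {..<p}"]) auto
      then have fin: "finite S" by (simp add: S_def)
      have "\<exists>d\<in>S. d \<le> W / \<delta>"
      proof (rule ccontr)
        assume far: "\<not> (\<exists>d\<in>S. d \<le> W / \<delta>)"
        \<comment> \<open>Inserting 1 covers orbits without any pair, in particular period one, and
          keeps \<open>D\<close> a power of \<open>\<theta>\<close>.\<close>
        define D where "D = Min (insert 1 S)"
        have D_in: "D \<in> insert 1 S" unfolding D_def using fin by (intro Min_in) auto
        have D_le: "D \<le> d" if "d \<in> S" for d unfolding D_def using fin that by (intro Min_le) auto
        have "W / \<delta> \<le> D" using D_in far True \<delta> by (auto simp: not_le)
        then have WD: "W \<le> \<delta> * D" using \<delta> by (simp add: field_simps)
        obtain s where s: "D = \<theta> ^ s"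
        proof (cases "D = 1")
          case True
          then show ?thesis using that[of 0] by simp
        next
          case False
          then have "D \<in> S" using D_in by simp
          then obtain a b where ab: "D = sd ((shift ^^ a) x) ((shift ^^ b) x)"
            by (auto simp: S_def)
          have "0 \<le> W / \<delta>" using W0 \<delta> by simp
          then have "D \<noteq> 0" using far \<open>D \<in> S\<close> by auto
          then show ?thesis using sd_power that ab sd_self by metis
        qed
        have "\<theta> ^ s \<le> sd ((shift ^^ a) x) ((shift ^^ b) x)" if "a < b" "b < p" for a b
        proof -
          have "sd ((shift ^^ a) x) ((shift ^^ b) x) \<in> S"
            unfolding S_def using that by (intro image_eqI[of _ _ "(a, b)"]) auto
          then show ?thesis using D_le s by simp
        qed
        then show False using none[of p x s] less.prems WD s by (simp add: W_def)
      qed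
      then obtain a b where ab: "a < b" "b < p"
        and d: "sd ((shift ^^ a) x) ((shift ^^ b) x) \<le> W / \<delta>"
        by (auto simp: S_def)
      obtain l y where l: "1 \<le> l" "2 * l \<le> p" "(shift ^^ l) y = y"
        and y: "- birkhoff F l y
          \<le> W + K / (1 - \<theta>)\<^sup>2 * sd ((shift ^^ a) x) ((shift ^^ b) x)"
        using split_periodic[OF K F F0 less.prems(2) ab] unfolding W_def by metis
      have "K / (1 - \<theta>)\<^sup>2 * sd ((shift ^^ a) x) ((shift ^^ b) x) \<le> K / (1 - \<theta>)\<^sup>2 * (W / \<delta>)"
        using d K by (intro mult_left_mono) auto
      then have y: "- birkhoff F l y \<le> \<kappa> * W"
        using y by (simp add: \<kappa>_def algebra_simps)
      have "\<delta> \<le> real l ^ N * - birkhoff F l y"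
        by (rule less.IH) (use l in auto)
      also have "\<dots> \<le> real l ^ N * (\<kappa> * W)" using y by (intro mult_left_mono) auto
      also have "\<dots> \<le> real l ^ N * (2 ^ N * W)"
        using N W0 by (intro mult_left_mono mult_right_mono) auto
      also have "\<dots> = real (2 * l) ^ N * W" by (simp add: power_mult_distrib)
      also have "\<dots> \<le> real p ^ N * W"
        using l(2) W0 by (intro mult_right_mono power_mono of_nat_mono) auto
      finally show ?thesis by (simp add: W_def)
    qed
  qed
  obtain p x where "1 \<le> p" "(shift ^^ p) x = x" "real p ^ N * - birkhoff F p x < \<delta>"
    using superpolynomial_periodic[OF K F near \<delta>] by metis
  then show False using lower[of p x] by linarith
qed

end

section \<open>Penalising the distance to a periodic orbit\<close>

context shift_space
begin

definition orbit_dist :: "nat \<Rightarrow> (nat \<Rightarrow> 'k) \<Rightarrow> (nat \<Rightarrow> 'k) \<Rightarrow> real" where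
  "orbit_dist p q x = Min ((\<lambda>j. sd x ((shift ^^ j) q)) ` {..<p})"

lemma orbit_dist_attained:
  assumes "1 \<le> p"
  obtains c where "orbit_dist p q x = sd x ((shift ^^ c) q)"
proof -
  have "orbit_dist p q x \<in> (\<lambda>j. sd x ((shift ^^ j) q)) ` {..<p}"
    unfolding orbit_dist_def using assms by (intro Min_in) (auto simp: lessThan_empty_iff)
  then show ?thesis using that by auto
qed

lemma orbit_dist_le:
  assumes "1 \<le> p" "(shift ^^ p) q = q"
  shows "orbit_dist p q x \<le> sd x ((shift ^^ c) q)"
proof -
  have "c mod p < p" using assms(1) by simp
  then have "orbit_dist p q x \<le> sd x ((shift ^^ (c mod p)) q)"
    unfolding orbit_dist_def by (intro Min_le) auto
  then show ?thesis by (simp add: funpow_shift_mod[OF assms(2)])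
qed

lemma orbit_dist_nonneg:
  assumes "1 \<le> p"
  shows "0 \<le> orbit_dist p q x"
  using orbit_dist_attained[OF assms, of q x] by (metis sd_nonneg)

lemma slip_orbit_dist:
  assumes "1 \<le> p" "(shift ^^ p) q = q"
  shows "slip 1 (orbit_dist p q)"
proof -
  have le: "orbit_dist p q x \<le> orbit_dist p q y + sd x y" for x y
  proof -
    obtain c where "orbit_dist p q y = sd y ((shift ^^ c) q)"
      by (rule orbit_dist_attained[OF assms(1)])
    then show ?thesis
      using orbit_dist_le[OF assms, of x c] sd_triangle[of x "(shift ^^ c) q" y] by simp
  qed
  show ?thesis
    unfolding slip_def
  proof (intro allI)
    fix x y
    show "\<bar>orbit_dist p q x - orbit_dist p q y\<bar> \<le> 1 * sd x y"
      using le[of x y] le[of y x] sd_commute[of x y] by (simp add: abs_le_iff)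
  qed
qed

lemma orbit_dist_eq_0:
  assumes "1 \<le> p" "orbit_dist p q x = 0"
  shows "\<exists>c. x = (shift ^^ c) q"
  by (metis assms orbit_dist_attained sd_eq_0_iff)

end

text \<open>\<open>h\<close> is the perturbation, and the bound on \<open>r\<close> limits its
  effect over a period to \<open>\<delta> * \<theta> ^ s\<close>. The first upper bound on
  \<open>\<delta>\<close> makes the penalised function nonpositive at distance
  \<open>\<theta> ^ (s + M)\<close> or more from the orbit; the second makes the penalty at distance
  \<open>\<theta> ^ (s + 1)\<close> exceed everything gained during an excursion near the
  orbit.\<close>

locale separated_orbit = shift_space +
  fixes F h :: "(nat \<Rightarrow> 'k) \<Rightarrow> real" and K \<epsilon> \<delta> r :: real and M s p :: nat and q :: "nat \<Rightarrow> 'k"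
  assumes K: "0 \<le> K" and F: "slip K F" and F0: "\<And>x. F x \<le> 0" and eps: "0 < \<epsilon>"
    and M: "1 \<le> M" and delta: "0 < \<delta>" "2 * \<delta> \<le> \<epsilon> * \<theta> ^ M"
      "4 * \<delta> + (K + 1) * \<theta> ^ M / (1 - \<theta>) \<le> \<epsilon> * \<theta>"
    and p: "1 \<le> p" and q: "(shift ^^ p) q = q"
    and sep: "\<And>a b. a < b \<Longrightarrow> b < p \<Longrightarrow> \<theta> ^ s \<le> sd ((shift ^^ a) q) ((shift ^^ b) q)"
    and small: "- birkhoff F p q \<le> \<delta> * \<theta> ^ s"
    and h: "slip 1 h" and h_le: "\<And>x. \<bar>h x\<bar> \<le> r" and r: "2 * r * real p \<le> \<delta> * \<theta> ^ s"
begin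

definition H :: "(nat \<Rightarrow> 'k) \<Rightarrow> real" where "H x = F x + h x"

definition avg :: real where "avg = birkhoff H p q / real p"

text \<open>Sums to zero over a period of \<open>q\<close>, since the penalty vanishes there.
  \<open>H\<close> itself need not have \<open>avg\<close> as its largest mean.\<close>

definition G :: "(nat \<Rightarrow> 'k) \<Rightarrow> real" where "G x = (H x - avg) - \<epsilon> * orbit_dist p q x"

abbreviation E :: real where "E \<equiv> 2 * \<delta> * \<theta> ^ s"

text \<open>\<open>F\<close> is nonpositive, and its mean over the orbit is at least
  \<open>- \<delta> * \<theta> ^ s / p\<close>. The division by \<open>p\<close> matters: up to
  \<open>p\<close> steps together gain no more than \<open>E\<close>.\<close>

lemma H_avg_le_mean: "H x - avg \<le> 2 * r + (\<delta> * \<theta> ^ s) / real p"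
proof -
  have "- real p * r \<le> birkhoff h p q"
    using sum_bounded_below[of "{..<p}" "- r" "\<lambda>j. h ((shift ^^ j) q)"] h_le
    by (simp add: birkhoff_def abs_le_iff minus_le_iff)
  moreover have "birkhoff H p q = birkhoff F p q + birkhoff h p q"
    unfolding H_def by (rule birkhoff_plus)
  ultimately have "- (\<delta> * \<theta> ^ s) - real p * r \<le> birkhoff H p q" using small by linarith
  then have "(- (\<delta> * \<theta> ^ s) - real p * r) / real p \<le> avg"
    unfolding avg_def by (intro divide_right_mono) auto
  moreover have "(- (\<delta> * \<theta> ^ s) - real p * r) / real p = - (\<delta> * \<theta> ^ s) / real p - r"
    using p by (simp add: diff_divide_distrib)
  ultimately have "- (\<delta> * \<theta> ^ s) / real p - r \<le> avg" by linarith
  moreover have "H x \<le> r" using F0[of x] h_le[of x] by (simp add: H_def)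
  ultimately show ?thesis by simp
qed

lemma r_nonneg: "0 \<le> r"
  using h_le[of q] by linarith

lemma H_avg_le: "H x - avg \<le> E"
proof -
  have "0 \<le> \<delta> * \<theta> ^ s" using delta theta_pos by simp
  then have "(\<delta> * \<theta> ^ s) / real p \<le> \<delta> * \<theta> ^ s"
    using p mult_left_mono[of 1 "real p" "\<delta> * \<theta> ^ s"] by (simp add: divide_le_eq)
  moreover have "2 * r * 1 \<le> 2 * r * real p" using p r_nonneg by (intro mult_left_mono) auto
  ultimately show ?thesis using H_avg_le_mean[of x] r by linarith
qed

text \<open>Whole periods contribute nothing, so only the fewer than \<open>p\<close> remaining
  steps count; hence the bound does not depend on \<open>n\<close>.\<close>

lemma birkhoff_orbit_le: "birkhoff (\<lambda>x. H x - avg) n ((shift ^^ c) q) \<le> E"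
proof -
  let ?H = "\<lambda>x. H x - avg" and ?q = "(shift ^^ c) q"
  have per: "(shift ^^ p) ?q = ?q" by (rule funpow_shift_periodic_iterate[OF q])
  have "birkhoff ?H p ?q = 0"
    using p by (simp add: birkhoff_minus_const avg_def birkhoff_cyclic[OF q])
  then have "birkhoff ?H (n div p * p) ?q = 0" by (simp add: birkhoff_periodic[OF per])
  then have "birkhoff ?H n ?q = birkhoff ?H (n mod p) ?q"
    using birkhoff_add[of ?H "n div p * p" "n mod p" ?q] funpow_shift_periodic[OF per] by simp
  also have "\<dots> \<le> real (n mod p) * (2 * r + (\<delta> * \<theta> ^ s) / real p)"
    using sum_bounded_above[of "{..<n mod p}" "\<lambda>j. ?H ((shift ^^ j) ?q)"] H_avg_le_mean
    by (simp add: birkhoff_def)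
  also have "\<dots> \<le> real p * (2 * r + (\<delta> * \<theta> ^ s) / real p)"
    using p r_nonneg delta theta_pos by (intro mult_right_mono of_nat_mono) auto
  also have "\<dots> = 2 * r * real p + \<delta> * \<theta> ^ s" using p by (simp add: algebra_simps)
  also have "\<dots> \<le> E" using r by simp
  finally show ?thesis .
qed

lemma separated:
  assumes "sd ((shift ^^ a) q) ((shift ^^ b) q) < \<theta> ^ s"
  shows "(shift ^^ a) q = (shift ^^ b) q"
proof -
  have lt: "a mod p < p" "b mod p < p" using p by auto
  have "a mod p = b mod p"
    using sep[of "a mod p" "b mod p"] sep[of "b mod p" "a mod p"] lt assms
      sd_commute[of "(shift ^^ a) q" "(shift ^^ b) q"]
    unfolding funpow_shift_mod[OF q] by (metis linorder_neqE_nat not_less)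
  then show ?thesis by (metis funpow_shift_mod[OF q])
qed

lemma slip_H: "slip (K + 1) (\<lambda>x. H x - avg)"
  unfolding H_def using slip_add[OF slip_add[OF F h] slip_const[of "- avg"]] by simp

lemma G_le: "G x \<le> E - \<epsilon> * orbit_dist p q x"
  using H_avg_le[of x] by (simp add: G_def)

lemma birkhoff_G_le: "birkhoff G n x \<le> birkhoff (\<lambda>x. H x - avg) n x"
  unfolding G_def using eps orbit_dist_nonneg[OF p, of q] by (intro birkhoff_mono) simp

text \<open>An excursion of \<open>x\<close> near the orbit of \<open>q\<close> starts at distance \<open>\<theta> ^ R\<close> and lasts until the
  distance is \<open>\<theta> ^ (s + 1)\<close>; up to time \<open>R - s - M\<close> Birkhoff sums are compared with those of the
  orbit, afterwards \<open>G\<close> is nonpositive, and its last value compensates what was gained before.\<close>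

lemma orbit_dist_excursion:
  assumes R: "\<forall>i<R. x i = (shift ^^ c) q i" "x R \<noteq> (shift ^^ c) q R" and j: "s + j < R"
  shows "\<theta> ^ (R - j) \<le> orbit_dist p q ((shift ^^ j) x)"
proof (rule ccontr)
  assume neg: "\<not> ?thesis"
  obtain c' where c': "orbit_dist p q ((shift ^^ j) x) = sd ((shift ^^ j) x) ((shift ^^ c') q)"
    by (rule orbit_dist_attained[OF p])
  \<comment> \<open>If the claim fails, the orbit point nearest to \<open>(shift ^^ j) x\<close>
    agrees with it on \<open>R - j + 1\<close> symbols, and the shadowing point
    \<open>(shift ^^ (c + j)) q\<close> agrees with it on \<open>R - j > s\<close> symbols. By
    separation these two orbit points are equal, so the agreement with \<open>x\<close> extends to
    position \<open>R\<close>, where it was assumed to break.\<close>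
  have near: "\<forall>i\<le>R - j. (shift ^^ j) x i = (shift ^^ c') q i"
    using neg unfolding c' by (simp add: sd_less_power_iff not_le)
  have "(shift ^^ (c + j)) q i = (shift ^^ c') q i" if "i \<le> s" for i
  proof -
    have "(shift ^^ (c + j)) q i = (shift ^^ c) q (j + i)" by (simp add: funpow_shift add_ac)
    also have "\<dots> = x (j + i)" using R(1) j that by simp
    also have "\<dots> = (shift ^^ j) x i" by (simp add: funpow_shift)
    also have "\<dots> = (shift ^^ c') q i" using near j that by simp
    finally show ?thesis .
  qed
  then have "(shift ^^ (c + j)) q = (shift ^^ c') q"
    by (intro separated) (simp add: sd_less_power_iff)
  then have "(shift ^^ c) q R = (shift ^^ c') q (R - j)"
    using j by (metis add.commute add_diff_inverse_nat funpow_shift group_cancel.add1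
        less_imp_add_positive not_add_less2 trans_less_add2)
  moreover have "x R = (shift ^^ c') q (R - j)"
    using near[rule_format, of "R - j"] j by (simp add: funpow_shift)
  ultimately show False using R(2) by simp
qed

text \<open>Strong induction on \<open>n\<close> strips initial blocks with nonpositive sum: a
  single step far from the orbit, or a completed excursion. What is left is a piece that stays near
  the orbit up to time \<open>n\<close>, and shadowing bounds its sum.\<close>

lemma birkhoff_G_bounded: "birkhoff G n x \<le> E + (K + 1) / (1 - \<theta>)"
proof (induction n arbitrary: x rule: less_induct)
  case (less n)
  have E: "0 \<le> E" using delta theta_pos by simp
  have K1: "0 \<le> (K + 1) / (1 - \<theta>)" using K theta_less by simp
  have mono: "\<theta> ^ b \<le> \<theta> ^ a" if "a \<le> b" for a b
    using that theta_pos theta_less by (intro power_decreasing) auto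
  have far: "G y \<le> 0" if "\<theta> ^ (s + M) \<le> orbit_dist p q y" for y
  proof -
    have "E \<le> \<epsilon> * \<theta> ^ M * \<theta> ^ s" using delta(2) theta_pos by (intro mult_right_mono) auto
    also have "\<dots> = \<epsilon> * \<theta> ^ (s + M)" by (simp add: power_add)
    also have "\<dots> \<le> \<epsilon> * orbit_dist p q y" using that eps by simp
    finally show ?thesis using G_le[of y] by linarith
  qed
  have step: ?case if m: "1 \<le> m" "m \<le> n" "birkhoff G m x \<le> 0" for m
  proof -
    have "birkhoff G n x = birkhoff G m x + birkhoff G (n - m) ((shift ^^ m) x)"
      using birkhoff_add[of G m "n - m" x] m(2) by simp
    moreover have "birkhoff G (n - m) ((shift ^^ m) x) \<le> E + (K + 1) / (1 - \<theta>)"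
      using less.IH[of "n - m"] m by simp
    ultimately show ?thesis using m(3) by linarith
  qed
  show ?case
  proof (cases "n = 0")
    case True
    then show ?thesis using E K1 by simp
  next
    case n: False
    show ?thesis
    proof (cases "\<theta> ^ (s + M) \<le> orbit_dist p q x")
      case True
      have "birkhoff G 1 x = G x" by (simp add: birkhoff_def)
      then show ?thesis using far[OF True] n by (intro step[of 1]) auto
    next
      case False
      obtain c where c: "orbit_dist p q x = sd x ((shift ^^ c) q)"
        by (rule orbit_dist_attained[OF p])
      show ?thesis
      proof (cases "x = (shift ^^ c) q")
        case True
        then show ?thesis using birkhoff_G_le[of n x] birkhoff_orbit_le[of n c] K1 by simp
      next
        case ne: False
        obtain R where R: "sd x ((shift ^^ c) q) = \<theta> ^ R" "\<forall>i<R. x i = (shift ^^ c) q i"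
          "x R \<noteq> (shift ^^ c) q R"
          by (rule sd_power[OF ne])
        have "\<theta> ^ R < \<theta> ^ (s + M)" using False c R(1) by simp
        then have sMR: "s + M < R" using mono[of R "s + M"] by (metis not_less)
        \<comment> \<open>From time \<open>J\<close> until just before \<open>R - s\<close> the
          distance to the orbit is at least \<open>\<theta> ^ (s + M)\<close>, so \<open>G\<close>
          is nonpositive there; at time \<open>J\<close> the shadowing error is still only of order
          \<open>\<theta> ^ (s + M)\<close>.\<close>
        define J where "J = R - s - M"
        have shadow: "birkhoff G l x \<le> E + (K + 1) / (1 - \<theta>) * \<theta> ^ (R - l)" if "l \<le> J" for l
        proof -
          have lR: "l < R" using that sMR M by (simp add: J_def)
          have "sd ((shift ^^ l) x) ((shift ^^ l) ((shift ^^ c) q)) \<le> \<theta> ^ (R - l)"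
            unfolding sd_le_power_iff using R(2) lR by (simp add: funpow_shift)
          then have "(K + 1) / (1 - \<theta>) * sd ((shift ^^ l) x) ((shift ^^ l) ((shift ^^ c) q))
              \<le> (K + 1) / (1 - \<theta>) * \<theta> ^ (R - l)"
            using K1 by (intro mult_left_mono) auto
          moreover have "\<bar>birkhoff (\<lambda>x. H x - avg) l x - birkhoff (\<lambda>x. H x - avg) l ((shift ^^ c) q)\<bar>
              \<le> (K + 1) / (1 - \<theta>) * sd ((shift ^^ l) x) ((shift ^^ l) ((shift ^^ c) q))"
            using K R(2) lR by (intro birkhoff_shadow[OF slip_H]) auto
          ultimately show ?thesis
            using birkhoff_G_le[of l x] birkhoff_orbit_le[of l c] by linarith
        qed
        have escape: "birkhoff G (J + l) x \<le> birkhoff G J x" if "J + l \<le> R - s" for l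
        proof -
          have "G ((shift ^^ i) ((shift ^^ J) x)) \<le> 0" if "i < l" for i
          proof -
            have i: "s + (J + i) < R" using that \<open>J + l \<le> R - s\<close> by linarith
            have "R - (J + i) \<le> s + M" by (simp add: J_def)
            then have "\<theta> ^ (s + M) \<le> orbit_dist p q ((shift ^^ (J + i)) x)"
              using orbit_dist_excursion[OF R(2,3) i] mono order_trans by blast
            then show ?thesis using far by (simp add: funpow_shift_add)
          qed
          then have "birkhoff G l ((shift ^^ J) x) \<le> 0"
            unfolding birkhoff_def by (intro sum_nonpos) auto
          then show ?thesis by (simp add: birkhoff_add)
        qed
        have RJ: "R - J = s + M" using sMR by (simp add: J_def)
        show ?thesis
        proof (cases "n < R - s")
          case True
          have bound: "birkhoff G l x \<le> E + (K + 1) / (1 - \<theta>)" if "l \<le> J" for l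
          proof -
            have "(K + 1) / (1 - \<theta>) * \<theta> ^ (R - l) \<le> (K + 1) / (1 - \<theta>) * 1"
              using mono[of 0 "R - l"] K1 by (intro mult_left_mono) auto
            then show ?thesis using shadow[OF that] by linarith
          qed
          show ?thesis
          proof (cases "n \<le> J")
            case False
            then show ?thesis using escape[of "n - J"] bound[of J] True by simp
          qed (rule bound)
        next
          case False
          \<comment> \<open>The last time at which \<open>orbit_dist_excursion\<close> applies, with
            distance at least \<open>\<theta> ^ (s + 1)\<close>. The penalty of this one step
            outweighs one \<open>E\<close> from the orbit sum, one \<open>E\<close> from the step
            itself, and the shadowing error.\<close>
          define m where "m = R - s - 1"
          have m: "R - s = Suc m" "J \<le> m" using sMR M by (auto simp: m_def J_def)
          have sm: "s + m < R" "R - m = s + 1" using m sMR by auto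
          have "birkhoff G m x \<le> E + (K + 1) / (1 - \<theta>) * \<theta> ^ (s + M)"
            using escape[of "m - J"] shadow[of J] m RJ by simp
          moreover have "G ((shift ^^ m) x) \<le> E - \<epsilon> * \<theta> ^ (s + 1)"
          proof -
            have "\<epsilon> * \<theta> ^ (s + 1) \<le> \<epsilon> * orbit_dist p q ((shift ^^ m) x)"
              using orbit_dist_excursion[OF R(2,3) sm(1)] eps unfolding sm(2) by simp
            then show ?thesis using G_le[of "(shift ^^ m) x"] by linarith
          qed
          moreover have "E + (K + 1) / (1 - \<theta>) * \<theta> ^ (s + M) + (E - \<epsilon> * \<theta> ^ (s + 1)) \<le> 0"
          proof -
            have "(4 * \<delta> + (K + 1) * \<theta> ^ M / (1 - \<theta>)) * \<theta> ^ s \<le> \<epsilon> * \<theta> * \<theta> ^ s"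
              using delta(3) theta_pos by (intro mult_right_mono) auto
            then show ?thesis by (simp add: power_add algebra_simps)
          qed
          ultimately have "birkhoff G (R - s) x \<le> 0" unfolding m(1) birkhoff_Suc by linarith
          then show ?thesis using False m(1) by (intro step[of "R - s"]) auto
        qed
      qed
    qed
  qed
qed

end

section \<open>Invariant measures\<close>

context shift_space
begin

abbreviation sm :: "(nat \<Rightarrow> 'k) metric" where
  "sm \<equiv> shift_metric \<theta>"

lemma openin_shift_metric:
  fixes U :: "(nat \<Rightarrow> 'k) set"
  shows "openin (mtopology_of sm) U \<longleftrightarrow> (\<forall>x\<in>U. \<exists>e>0. \<forall>y. sd x y < e \<longrightarrow> y \<in> U)"
proof -
  have "mtopology_of sm = Metric_space.mtopology UNIV (sd :: (nat \<Rightarrow> 'k) \<Rightarrow> _)"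
    by (simp add: mtopology_of_def mspace_shift_metric[OF theta_pos theta_less]
        mdist_shift_metric[OF theta_pos theta_less])
  then show ?thesis
    by (auto simp: Metric_space.openin_mtopology[OF sd_metric] Metric_space.mball_def[OF sd_metric]
        subset_iff)
qed

lemma space_mborel_shift [simp]: "space (mborel sm) = UNIV"
  by (simp add: mborel_def mspace_shift_metric[OF theta_pos theta_less])

lemma sets_mborel_shift: "sets (mborel sm) = sigma_sets UNIV {U. openin (mtopology_of sm) U}"
  by (simp add: mborel_def mspace_shift_metric[OF theta_pos theta_less])

lemma open_in_sets: "openin (mtopology_of sm) U \<Longrightarrow> U \<in> sets (mborel sm)"
  by (simp add: sets_mborel_shift sigma_sets.Basic)

lemma openin_vimage_slip:
  assumes f: "slip K f" and S: "open S"
  shows "openin (mtopology_of sm) (f -` S)"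
  unfolding openin_shift_metric
proof
  fix x assume "x \<in> f -` S"
  then obtain e where e: "0 < e" "\<And>z. dist z (f x) < e \<Longrightarrow> z \<in> S"
    using S by (metis openE mem_ball dist_commute subsetD vimageE)
  have "y \<in> f -` S" if "sd x y < e / (\<bar>K\<bar> + 1)" for y
  proof -
    have "\<bar>f y - f x\<bar> \<le> K * sd x y" using slipD[OF f, of x y] by (simp add: abs_minus_commute)
    also have "\<dots> \<le> (\<bar>K\<bar> + 1) * sd x y" by (intro mult_right_mono) auto
    also have "\<dots> < e" using that by (simp add: pos_less_divide_eq mult.commute)
    finally show ?thesis using e(2)[of "f y"] by (simp add: dist_real_def)
  qed
  moreover have "0 < e / (\<bar>K\<bar> + 1)" using e(1) by simp
  ultimately show "\<exists>d>0. \<forall>y. sd x y < d \<longrightarrow> y \<in> f -` S" by blast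
qed

lemma slip_continuous:
  fixes f :: "(nat \<Rightarrow> 'k) \<Rightarrow> real"
  assumes "slip K f"
  shows "continuous_map (mtopology_of sm) euclideanreal f"
proof -
  have "topspace (mtopology_of sm) = (UNIV :: (nat \<Rightarrow> 'k) set)"
    by (simp add: mspace_shift_metric[OF theta_pos theta_less])
  then show ?thesis
    using openin_vimage_slip[OF assms] by (simp add: continuous_map_alt)
qed

lemma slip_measurable:
  assumes "slip K f"
  shows "f \<in> borel_measurable (mborel sm)"
  by (intro borel_measurableI) (simp add: open_in_sets[OF openin_vimage_slip[OF assms]])

lemma shift_measurable: "shift \<in> measurable (mborel sm) (mborel (sm :: (nat \<Rightarrow> 'k) metric))"
proof (rule measurable_sigma_sets[OF sets_mborel_shift])
  fix U :: "(nat \<Rightarrow> 'k) set" assume U: "U \<in> {U. openin (mtopology_of sm) U}"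
  have "openin (mtopology_of sm) (shift -` U)"
    unfolding openin_shift_metric
  proof
    fix x :: "nat \<Rightarrow> 'k" assume "x \<in> shift -` U"
    then obtain e where e: "0 < e" "\<And>y. sd (shift x) y < e \<Longrightarrow> y \<in> U"
      using U by (auto simp: openin_shift_metric)
    have "y \<in> shift -` U" if "sd x y < e * \<theta>" for y
    proof -
      have "sd x y / \<theta> < e" using that theta_pos by (simp add: pos_divide_less_eq)
      then show ?thesis using e(2)[of "shift y"] sd_shift_le[of x y] by simp
    qed
    then show "\<exists>d>0. \<forall>y. sd x y < d \<longrightarrow> y \<in> shift -` U"
      using e(1) theta_pos by (intro exI[of _ "e * \<theta>"]) auto
  qed
  then show "shift -` U \<inter> space (mborel sm) \<in> sets (mborel sm)" using open_in_sets by simp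
qed auto

lemma singleton_in_sets: "{x :: nat \<Rightarrow> 'k} \<in> sets (mborel sm)"
proof -
  have "openin (mtopology_of sm) (- {x})"
    unfolding openin_shift_metric
  proof
    fix y assume "y \<in> - {x}"
    then have "0 < sd y x" by (simp add: less_le sd_eq_0_iff eq_commute[of 0])
    then show "\<exists>e>0. \<forall>z. sd y z < e \<longrightarrow> z \<in> - {x}" by auto
  qed
  then have "space (mborel sm) - (- {x}) \<in> sets (mborel sm)"
    by (intro sets.compl_sets open_in_sets)
  then show ?thesis by (simp add: Compl_eq_Diff_UNIV[symmetric])
qed

lemma slip_le: "slip K f \<Longrightarrow> \<bar>f x\<bar> \<le> \<bar>f z\<bar> + \<bar>K\<bar>"
proof -
  assume "slip K f"
  then have "\<bar>f x - f z\<bar> \<le> K * sd x z" by (rule slipD)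
  also have "\<dots> \<le> \<bar>K\<bar> * sd x z" by (intro mult_right_mono) auto
  also have "\<dots> \<le> \<bar>K\<bar> * 1" by (intro mult_left_mono sd_le_1) auto
  finally show ?thesis by simp
qed

lemma slip_birkhoff:
  assumes "slip K f" "0 \<le> K"
  shows "\<exists>K'\<ge>0. slip K' (birkhoff f n)"
proof -
  have iterate: "\<exists>K'\<ge>0. slip K' (\<lambda>x. f ((shift ^^ j) x))" for j
  proof (induction j)
    case (Suc j)
    then obtain K' where "0 \<le> K'" "slip K' (\<lambda>x. f ((shift ^^ j) x))" by blast
    then have "slip (K' / \<theta>) (\<lambda>x. f ((shift ^^ j) (shift x)))" "0 \<le> K' / \<theta>"
      using slip_shift theta_pos by auto
    then show ?case unfolding funpow_Suc_right o_apply by blast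
  qed (use assms in auto)
  show ?thesis
  proof (induction n)
    case 0
    show ?case using slip_const[of 0] by (intro exI[of _ 0]) (simp add: birkhoff_def[abs_def])
  next
    case (Suc n)
    obtain K1 K2 where "0 \<le> K1" "slip K1 (birkhoff f n)" "0 \<le> K2"
      "slip K2 (\<lambda>x. f ((shift ^^ n) x))"
      using Suc iterate by blast
    then show ?case
      using slip_add[of K1 "birkhoff f n" K2] by (intro exI[of _ "K1 + K2"]) (simp add: birkhoff_Suc[abs_def])
  qed
qed

end

section \<open>Integrals against an invariant measure\<close>

locale invariant_measure = shift_space +
  fixes \<nu> :: "(nat \<Rightarrow> 'k) measure"
  assumes invariant: "\<nu> \<in> invariant_measures (shift_metric \<theta>) shift"
begin

sublocale prob_space \<nu>
  using invariant by (simp add: invariant_measures_def)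

lemma sets_nu: "sets \<nu> = sets (mborel sm)"
  using invariant by (simp add: invariant_measures_def)

lemma space_nu [simp]: "space \<nu> = UNIV"
  using sets_eq_imp_space_eq[OF sets_nu] by simp

lemma prob_UNIV [simp]: "prob UNIV = 1"
  using prob_space by simp

lemma shift_nu: "shift \<in> measurable \<nu> \<nu>" "distr \<nu> \<nu> shift = \<nu>"
  using invariant by (simp_all add: invariant_measures_def)

lemma slip_measurable_nu: "slip K f \<Longrightarrow> f \<in> borel_measurable \<nu>"
  using slip_measurable measurable_cong_sets[OF sets_nu refl] by blast

lemma slip_integrable:
  assumes "slip K f"
  shows "integrable \<nu> f"
  using slip_le[OF assms] slip_measurable_nu[OF assms]
  by (intro integrable_const_bound[of _ "\<bar>f undefined\<bar> + \<bar>K\<bar>"]) auto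

lemma integral_shift:
  assumes "slip K f"
  shows "(\<integral>x. f (shift x) \<partial>\<nu>) = (\<integral>x. f x \<partial>\<nu>)"
  using integral_distr[OF shift_nu(1) slip_measurable_nu[OF assms]] unfolding shift_nu(2) by simp

lemma integral_birkhoff:
  assumes f: "slip K f" "0 \<le> K"
  shows "(\<integral>x. birkhoff f n x \<partial>\<nu>) = real n * (\<integral>x. f x \<partial>\<nu>)"
proof (induction n)
  case (Suc n)
  obtain K1 where K1: "0 \<le> K1" "slip K1 (birkhoff f n)" using slip_birkhoff[OF f] by blast
  have "birkhoff f (Suc n) x = f x + birkhoff f n (shift x)" for x
    using birkhoff_add[of f 1 n x] by (simp add: birkhoff_def)
  then have "(\<integral>x. birkhoff f (Suc n) x \<partial>\<nu>) = (\<integral>x. f x + birkhoff f n (shift x) \<partial>\<nu>)"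
    by presburger
  also have "\<dots> = (\<integral>x. f x \<partial>\<nu>) + (\<integral>x. birkhoff f n (shift x) \<partial>\<nu>)"
    by (intro Bochner_Integration.integral_add slip_integrable[OF f(1)]
        slip_integrable[OF slip_shift[OF K1(2,1)]])
  finally show ?case
    using integral_shift[OF K1(2)] Suc by (simp add: distrib_right)
qed simp

text \<open>By invariance \<open>n\<close> times the integral is the integral of
  \<open>birkhoff f n\<close>, hence at most \<open>B\<close> for all \<open>n\<close>.\<close>

lemma integral_nonpos_of_bounded_birkhoff:
  assumes f: "slip K f" "0 \<le> K" and bound: "\<And>n x. birkhoff f n x \<le> B"
  shows "(\<integral>x. f x \<partial>\<nu>) \<le> 0"
proof (rule ccontr)
  assume "\<not> ?thesis"
  then have pos: "0 < (\<integral>x. f x \<partial>\<nu>)" by simp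
  then obtain n where n: "B < real n * (\<integral>x. f x \<partial>\<nu>)" using reals_Archimedean3 by blast
  obtain K1 where K1: "slip K1 (birkhoff f n)" using slip_birkhoff[OF f] by blast
  have "(\<integral>x. birkhoff f n x \<partial>\<nu>) \<le> (\<integral>x. B \<partial>\<nu>)"
    using bound by (intro integral_mono slip_integrable[OF K1]) auto
  then show False using n integral_birkhoff[OF f, of n] by (simp add: prob_space)
qed

text \<open>A bounded error vanishes after division by \<open>n\<close>. The proof also supplies the
  convergence without which the \<open>lim\<close> in \<open>mean_value\<close> would have no
  content.\<close>

lemma mean_value_eq:
  assumes f: "slip K f" "0 \<le> K" and meas: "\<And>n. 1 \<le> n \<Longrightarrow> \<psi> n \<in> borel_measurable \<nu>"
    and close: "\<And>n x. 1 \<le> n \<Longrightarrow> \<bar>\<psi> n x - birkhoff f n x\<bar> \<le> B"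
  shows "mean_value \<psi> \<nu> = (\<integral>x. f x \<partial>\<nu>)"
proof -
  let ?I = "\<integral>x. f x \<partial>\<nu>"
  have B: "0 \<le> B" using close[of 1 undefined] by linarith
  have "\<bar>1 / real n * (\<integral>x. \<psi> n x \<partial>\<nu>) - ?I\<bar> \<le> B / real n" if n: "1 \<le> n" for n
  proof -
    obtain K1 where K1: "slip K1 (birkhoff f n)" using slip_birkhoff[OF f] by blast
    note int_b = slip_integrable[OF K1]
    have int_d: "integrable \<nu> (\<lambda>x. \<psi> n x - birkhoff f n x)"
      using close[OF n] meas[OF n] slip_measurable_nu[OF K1]
      by (intro integrable_const_bound[of _ B]) auto
    have "integrable \<nu> (\<lambda>x. (\<psi> n x - birkhoff f n x) + birkhoff f n x)"
      by (intro Bochner_Integration.integrable_add int_b int_d)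
    then have int_psi: "integrable \<nu> (\<psi> n)" by simp
    have "\<bar>\<integral>x. \<psi> n x - birkhoff f n x \<partial>\<nu>\<bar> \<le> (\<integral>x. \<bar>\<psi> n x - birkhoff f n x\<bar> \<partial>\<nu>)"
      by (rule integral_abs_bound)
    also have "\<dots> \<le> (\<integral>x. B \<partial>\<nu>)"
      using close[OF n] by (intro integral_mono integrable_abs int_d) auto
    finally have "\<bar>(\<integral>x. \<psi> n x \<partial>\<nu>) - real n * ?I\<bar> \<le> B"
      using integral_birkhoff[OF f, of n] Bochner_Integration.integral_diff[OF int_psi int_b]
      by (simp add: prob_space)
    moreover have "1 / real n * (\<integral>x. \<psi> n x \<partial>\<nu>) - ?I = ((\<integral>x. \<psi> n x \<partial>\<nu>) - real n * ?I) / real n"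
      using n by (simp add: field_simps)
    ultimately show ?thesis by (simp add: divide_right_mono)
  qed
  then have "\<forall>\<^sub>F n in sequentially. norm (1 / real n * (\<integral>x. \<psi> n x \<partial>\<nu>) - ?I) \<le> B / real n"
    by (intro eventually_sequentiallyI[of 1]) (simp only: real_norm_def)
  moreover have "(\<lambda>n. B / real n) \<longlonglongrightarrow> 0" by (rule lim_const_over_n)
  ultimately have "(\<lambda>n. 1 / real n * (\<integral>x. \<psi> n x \<partial>\<nu>) - ?I) \<longlonglongrightarrow> 0" by (rule Lim_null_comparison)
  then have "(\<lambda>n. 1 / real n * (\<integral>x. \<psi> n x \<partial>\<nu>)) \<longlonglongrightarrow> ?I" by (rule LIM_zero_cancel)
  then show ?thesis unfolding mean_value_def by (rule limI)
qed

end

section \<open>The measure carried by a periodic orbit\<close>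

context shift_space
begin

definition orbit :: "nat \<Rightarrow> (nat \<Rightarrow> 'k) \<Rightarrow> (nat \<Rightarrow> 'k) set" where
  "orbit p q = (\<lambda>j. (shift ^^ j) q) ` {..<p}"

lemma finite_orbit [simp]: "finite (orbit p q)"
  by (simp add: orbit_def)

lemma iterate_in_orbit:
  assumes "1 \<le> p" "(shift ^^ p) q = q"
  shows "(shift ^^ c) q \<in> orbit p q"
  unfolding orbit_def
  by (rule image_eqI[of _ _ "c mod p"]) (use assms in \<open>auto simp: funpow_shift_mod\<close>)

lemma shift_image_orbit:
  assumes p: "1 \<le> p" and q: "(shift ^^ p) q = q"
  shows "shift ` orbit p q = orbit p q"
proof
  show "shift ` orbit p q \<subseteq> orbit p q"
  proof clarify
    fix x assume "x \<in> orbit p q"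
    then obtain j where "x = (shift ^^ j) q" by (auto simp: orbit_def)
    then show "shift x \<in> orbit p q" using iterate_in_orbit[OF p q, of "Suc j"] by simp
  qed
  show "orbit p q \<subseteq> shift ` orbit p q"
  proof
    fix x assume "x \<in> orbit p q"
    then obtain j where j: "x = (shift ^^ j) q" by (auto simp: orbit_def)
    have "(shift ^^ (j + p)) q = x"
      using funpow_shift_periodic_iterate[OF q, of j] j by (simp add: funpow_shift_add)
    then have "shift ((shift ^^ (j + p - 1)) q) = x"
      using p by (cases "j + p") auto
    then show "x \<in> shift ` orbit p q" using iterate_in_orbit[OF p q] by blast
  qed
qed

lemma finite_in_sets:
  fixes A :: "(nat \<Rightarrow> 'k) set"
  assumes "finite A"
  shows "A \<in> sets (mborel sm)"
  by (rule sets.countable[OF singleton_in_sets countable_finite[OF assms]])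

lemma sets_orbit_measure: "sets (orbit_measure sm Q) = sets (mborel sm)"
  by (simp add: orbit_measure_def)

lemma id_measurable_orbit:
  "(\<lambda>x. x) \<in> measurable (uniform_count_measure Q) (mborel (sm :: (nat \<Rightarrow> 'k) metric))"
  by (rule measurableI) (auto simp: space_uniform_count_measure sets_uniform_count_measure)

lemma emeasure_orbit_measure:
  assumes "finite Q" "A \<in> sets (mborel sm)"
  shows "emeasure (orbit_measure sm Q) A = ennreal (card (Q \<inter> A) / card Q)"
  using assms
  by (simp add: orbit_measure_def emeasure_distr[OF id_measurable_orbit] space_uniform_count_measure
      emeasure_uniform_count_measure Int_commute)

lemma integral_orbit_measure:
  assumes "finite Q" "slip K f"
  shows "(\<integral>x. f x \<partial>orbit_measure sm Q) = (\<Sum>x\<in>Q. f x) / card Q"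
  using integral_distr[OF id_measurable_orbit slip_measurable[OF assms(2)]]
  by (simp add: orbit_measure_def integral_uniform_count_measure[OF assms(1)])

text \<open>\<open>p\<close> may be any period, not the least one, so the argument works with the
  set: \<open>shift\<close> maps the finite orbit onto itself and therefore permutes it.\<close>

lemma orbit_measure_invariant:
  assumes p: "1 \<le> p" and q: "(shift ^^ p) q = q"
  shows "orbit_measure sm (orbit p q) \<in> invariant_measures sm shift"
proof -
  let ?Q = "orbit p q" and ?\<mu> = "orbit_measure sm (orbit p q)"
  have ne: "?Q \<noteq> {}" using iterate_in_orbit[OF p q] by blast
  have "prob_space (uniform_count_measure ?Q)"
    using ne by (intro prob_space_uniform_count_measure) auto
  then have "prob_space ?\<mu>"
    unfolding orbit_measure_def using id_measurable_orbit by (rule prob_space.prob_space_distr)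
  moreover have meas: "shift \<in> measurable ?\<mu> ?\<mu>"
    using shift_measurable measurable_cong_sets[OF sets_orbit_measure sets_orbit_measure] by blast
  moreover have "distr ?\<mu> ?\<mu> shift = ?\<mu>"
  proof (rule measure_eqI)
    fix A assume "A \<in> sets (distr ?\<mu> ?\<mu> shift)"
    then have A: "A \<in> sets ?\<mu>" by simp
    have sp: "space ?\<mu> = UNIV" by (simp add: orbit_measure_def)
    have inj: "inj_on shift ?Q"
      using shift_image_orbit[OF p q] by (intro finite_surj_inj) simp_all
    have "shift ` (?Q \<inter> shift -` A) = shift ` ?Q \<inter> A" by blast
    then have "shift ` (?Q \<inter> shift -` A) = ?Q \<inter> A" by (simp only: shift_image_orbit[OF p q])
    moreover have "inj_on shift (?Q \<inter> shift -` A)" by (rule inj_on_subset[OF inj]) simp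
    ultimately have "card (?Q \<inter> shift -` A) = card (?Q \<inter> A)" by (metis card_image)
    moreover have "shift -` A \<in> sets (mborel sm)"
      using measurable_sets[OF meas A] sp by (simp add: sets_orbit_measure)
    ultimately show "emeasure (distr ?\<mu> ?\<mu> shift) A = emeasure ?\<mu> A"
      using A by (simp add: emeasure_distr[OF meas] sp emeasure_orbit_measure sets_orbit_measure)
  qed simp
  ultimately show ?thesis by (simp add: invariant_measures_def sets_orbit_measure)
qed

end

context invariant_measure
begin

lemma eq_orbit_measure:
  assumes p: "1 \<le> p" and q: "(shift ^^ p) q = q" and AE: "AE x in \<nu>. x \<in> orbit p q"
  shows "\<nu> = orbit_measure sm (orbit p q)"
proof -
  let ?Q = "orbit p q"
  define c where "c j = prob {(shift ^^ j) q}" for j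
  have single: "{x} \<in> sets \<nu>" for x using singleton_in_sets by (simp add: sets_nu)
  \<comment> \<open>The preimage of the next point contains the present one, so invariance makes the
    mass nondecreasing along the orbit; periodicity then makes it constant.\<close>
  have c_Suc: "c j \<le> c (Suc j)" for j
  proof -
    let ?x = "(shift ^^ j) q"
    have "measure (distr \<nu> \<nu> shift) {shift ?x} = prob (shift -` {shift ?x} \<inter> space \<nu>)"
      by (rule measure_distr[OF shift_nu(1) single])
    then have "c (Suc j) = prob (shift -` {shift ?x})" by (simp add: shift_nu(2) c_def)
    moreover have "prob {?x} \<le> prob (shift -` {shift ?x})"
      using measurable_sets[OF shift_nu(1) single] by (intro finite_measure_mono) auto
    ultimately show ?thesis by (simp add: c_def)
  qed
  have c_eq: "c j = c 0" for j
  proof -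
    have mono: "mono c" using c_Suc by (simp add: mono_iff_le_Suc)
    have "c (j * p) = c 0" using funpow_shift_periodic[OF q, of j] by (simp add: c_def)
    moreover have "j \<le> j * p" using p by simp
    ultimately show ?thesis using monoD[OF mono, of 0 j] monoD[OF mono, of j "j * p"] by simp
  qed
  have point: "prob {x} = c 0" if "x \<in> ?Q" for x
    using that c_eq by (auto simp: orbit_def c_def)
  have fin: "prob A = real (card A) * c 0" if "A \<subseteq> ?Q" for A
  proof -
    have "prob A = (\<Sum>x\<in>A. prob {x})"
      using finite_subset[OF that] single by (intro finite_measure_eq_sum_singleton) auto
    also have "\<dots> = (\<Sum>x\<in>A. c 0)" using that point by (intro sum.cong) auto
    finally show ?thesis by simp
  qed
  have "?Q \<in> sets \<nu>" by (simp add: sets_nu finite_in_sets)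
  then have "prob ?Q = 1" using AE by (simp add: prob_eq_1)
  then have c: "real (card ?Q) * c 0 = 1" using fin[of ?Q] by simp
  show ?thesis
  proof (rule measure_eqI)
    show "sets \<nu> = sets (orbit_measure sm ?Q)" by (simp add: sets_nu sets_orbit_measure)
    fix A assume A: "A \<in> sets \<nu>"
    have "emeasure \<nu> A = emeasure \<nu> (?Q \<inter> A)"
      using AE A \<open>?Q \<in> sets \<nu>\<close> by (intro emeasure_eq_AE) auto
    also have "\<dots> = ennreal (real (card (?Q \<inter> A)) * c 0)"
      using fin[of "?Q \<inter> A"] by (simp add: emeasure_eq_measure)
    also have "c 0 = 1 / real (card ?Q)"
    proof -
      have "real (card ?Q) \<noteq> 0" using c by auto
      then show ?thesis using c by (simp add: field_simps)
    qed
    finally show "emeasure \<nu> A = emeasure (orbit_measure sm ?Q) A"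
      using A by (simp add: emeasure_orbit_measure sets_nu)
  qed
qed

end

section \<open>Periodic maximization that is stable under perturbation\<close>

context shift_space
begin

text \<open>\<open>M\<close> is fixed first, so that its term takes at most half of
  \<open>\<epsilon> * \<theta>\<close>; \<open>\<delta>\<close> is fitted to the other half and to
  the scale \<open>\<theta> ^ M\<close>.\<close>

lemma small_constants:
  assumes "0 < \<epsilon>" "0 \<le> K"
  obtains M \<delta> where "1 \<le> M" "0 < \<delta>" "2 * \<delta> \<le> \<epsilon> * \<theta> ^ M"
    "4 * \<delta> + K * \<theta> ^ M / (1 - \<theta>) \<le> \<epsilon> * \<theta>"
proof -
  have "0 < \<epsilon> * \<theta> * (1 - \<theta>) / (2 * (K + 1))"
    using assms theta_pos theta_less by simp
  then obtain n where n: "\<theta> ^ n < \<epsilon> * \<theta> * (1 - \<theta>) / (2 * (K + 1))"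
    using real_arch_pow_inv theta_less by blast
  define M where "M = Suc n"
  define \<delta> where "\<delta> = min (\<epsilon> * \<theta> / 8) (\<epsilon> * \<theta> ^ M / 2)"
  have "\<theta> ^ M \<le> \<theta> ^ n" using theta_pos theta_less unfolding M_def by (intro power_decreasing) auto
  then have "K * \<theta> ^ M \<le> (K + 1) * \<theta> ^ n" using assms theta_pos by (intro mult_mono) auto
  also have "\<dots> \<le> (K + 1) * (\<epsilon> * \<theta> * (1 - \<theta>) / (2 * (K + 1)))"
    using n assms by (intro mult_left_mono) auto
  also have "\<dots> = \<epsilon> * \<theta> / 2 * (1 - \<theta>)" using assms by (simp add: field_simps)
  finally have "K * \<theta> ^ M / (1 - \<theta>) \<le> \<epsilon> * \<theta> / 2" using theta_less by (simp add: pos_divide_le_eq)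
  moreover have "4 * \<delta> \<le> \<epsilon> * \<theta> / 2" by (simp add: \<delta>_def min_def)
  ultimately have "4 * \<delta> + K * \<theta> ^ M / (1 - \<theta>) \<le> \<epsilon> * \<theta>" by linarith
  moreover have "2 * \<delta> \<le> \<epsilon> * \<theta> ^ M" by (simp add: \<delta>_def min_def)
  moreover have "0 < \<delta>" "1 \<le> M" using assms theta_pos by (auto simp: M_def \<delta>_def)
  ultimately show ?thesis using that by blast
qed

text \<open>A quantitative form of Contreras's theorem for the full shift.\<close>

lemma stable_periodic_maximizer:
  fixes A :: "(nat \<Rightarrow> 'k::finite) \<Rightarrow> real"
  assumes A: "slip L A" "0 \<le> L" and e: "0 < e"
  obtains p q r where "1 \<le> p" "(shift ^^ p) q = q" "0 < r"
    "\<forall>h \<nu>. slip 1 h \<longrightarrow> (\<forall>x. \<bar>h x\<bar> \<le> r) \<longrightarrow> \<nu> \<in> invariant_measures sm shift \<longrightarrow>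
      \<nu> \<noteq> orbit_measure sm (orbit p q) \<longrightarrow>
      (\<integral>x. A x + h x - e * orbit_dist p q x \<partial>\<nu>)
        < (\<integral>x. A x + h x - e * orbit_dist p q x \<partial>orbit_measure sm (orbit p q))"
proof -
  obtain F u \<beta> K where K: "0 \<le> K" and F: "slip K F" and u: "slip K u"
    and F_eq: "\<And>x. F x = (A x - \<beta>) + (u x - u (shift x))" and F0: "\<And>x. F x \<le> 0"
    and near: "\<And>n \<eta>. 0 < \<eta> \<Longrightarrow> \<exists>x. \<forall>j<n. - \<eta> \<le> F ((shift ^^ j) x)"
    by (rule mane[OF A]) blast
  \<comment> \<open>One half of the penalty goes into \<open>G\<close> and keeps its Birkhoff sums
    bounded; the other half makes the inequality strict for measures not carried by the
    orbit.\<close>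
  define \<epsilon> where "\<epsilon> = e / 2"
  have eps: "0 < \<epsilon>" and e_eq: "e = 2 * \<epsilon>" using e by (simp_all add: \<epsilon>_def)
  obtain M \<delta> where M: "1 \<le> M" and delta: "0 < \<delta>" "2 * \<delta> \<le> \<epsilon> * \<theta> ^ M"
    "4 * \<delta> + (K + 1) * \<theta> ^ M / (1 - \<theta>) \<le> \<epsilon> * \<theta>"
    using small_constants[OF eps, of "K + 1"] K by auto
  obtain p s q where p: "1 \<le> p" and q: "(shift ^^ p) q = q"
    and sep: "\<And>a b. a < b \<Longrightarrow> b < p \<Longrightarrow> \<theta> ^ s \<le> sd ((shift ^^ a) q) ((shift ^^ b) q)"
    and small: "- birkhoff F p q \<le> \<delta> * \<theta> ^ s"
    using separated_periodic[OF K F F0 near delta(1)] by metis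
  define r where "r = \<delta> * \<theta> ^ s / (2 * real p)"
  have r: "0 < r" "2 * r * real p \<le> \<delta> * \<theta> ^ s" using p delta theta_pos by (auto simp: r_def)
  let ?\<mu> = "orbit_measure sm (orbit p q)" and ?od = "orbit_dist p q"
  note od = slip_orbit_dist[OF p q]
  show ?thesis
  proof (rule that[OF p q r(1)], intro allI impI)
    fix h :: "(nat \<Rightarrow> 'k) \<Rightarrow> real" and \<nu>
    assume h: "slip 1 h" "\<forall>x. \<bar>h x\<bar> \<le> r" and \<nu>: "\<nu> \<in> invariant_measures sm shift"
      and ne: "\<nu> \<noteq> ?\<mu>"
    interpret so: separated_orbit \<theta> F h K \<epsilon> \<delta> r M s p q
      by standard (use K F F0 eps M delta p q sep small h r in auto)
    let ?B = "\<lambda>x. A x + h x - e * ?od x"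
    have slip_G: "slip (K + 1 + \<epsilon>) so.G"
      using slip_add[OF so.slip_H slip_uminus[OF slip_cmult[OF od, of \<epsilon>]]] eps
      unfolding so.G_def[abs_def] by simp
    \<comment> \<open>The coboundary of \<open>u\<close> has integral zero, so only
      \<open>G\<close>, a constant and the second half of the penalty matter.\<close>
    have B_eq: "?B x = so.G x + (\<beta> + so.avg) + (u (shift x) - u x) - \<epsilon> * ?od x" for x
      unfolding so.G_def so.H_def F_eq e_eq by (simp add: algebra_simps)
    have int_B: "(\<integral>x. ?B x \<partial>\<kappa>)
        = (\<integral>x. so.G x \<partial>\<kappa>) + (\<beta> + so.avg) - \<epsilon> * (\<integral>x. ?od x \<partial>\<kappa>)"
      if "\<kappa> \<in> invariant_measures sm shift" for \<kappa>
    proof -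
      interpret invariant_measure \<theta> \<kappa> by standard (rule that)
      note [simp] = slip_integrable[OF slip_G] slip_integrable[OF u] slip_integrable[OF od]
        slip_integrable[OF slip_shift[OF u K]]
      show ?thesis unfolding B_eq by (simp add: integral_shift[OF u])
    qed
    interpret invariant_measure \<theta> \<nu> by standard (rule \<nu>)
    have od0: "0 \<le> ?od x" for x by (rule orbit_dist_nonneg[OF p])
    have on_orbit: "?od x = 0" if x: "x \<in> orbit p q" for x
    proof -
      obtain j where "x = (shift ^^ j) q" using x by (auto simp: orbit_def)
      then show ?thesis using orbit_dist_le[OF p q, of x j] od0[of x] by simp
    qed
    have "(\<integral>x. so.G x \<partial>\<nu>) \<le> 0"
      using integral_nonpos_of_bounded_birkhoff[OF slip_G _ so.birkhoff_G_bounded] K eps by simp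
    moreover have od_pos: "0 < (\<integral>x. ?od x \<partial>\<nu>)"
    proof (rule ccontr)
      assume "\<not> ?thesis"
      moreover have "0 \<le> (\<integral>x. ?od x \<partial>\<nu>)" using od0 by (intro integral_nonneg_AE) auto
      ultimately have "(\<integral>x. ?od x \<partial>\<nu>) = 0" by simp
      then have "AE x in \<nu>. ?od x = 0"
        using integral_nonneg_eq_0_iff_AE[OF slip_integrable[OF od]] od0 by simp
      then have "AE x in \<nu>. x \<in> orbit p q"
        using orbit_dist_eq_0[OF p] iterate_in_orbit[OF p q] by (auto elim!: eventually_mono)
      then show False using eq_orbit_measure[OF p q] ne by simp
    qed
    moreover have "(\<integral>x. so.G x \<partial>?\<mu>) = 0"
    proof -
      \<comment> \<open>By separation the \<open>p\<close> iterates are distinct, so the sum over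
        the orbit as a set is the Birkhoff sum over \<open>p\<close> steps.\<close>
      have inj: "inj_on (\<lambda>j. (shift ^^ j) q) {..<p}"
      proof (rule linorder_inj_onI)
        fix i j assume "i < j" "i \<in> {..<p}" "j \<in> {..<p}"
        then have "\<theta> ^ s \<le> sd ((shift ^^ i) q) ((shift ^^ j) q)" using sep by simp
        moreover have "0 < \<theta> ^ s" using theta_pos by simp
        ultimately show "(shift ^^ i) q \<noteq> (shift ^^ j) q" by auto
      qed auto
      have "(\<Sum>x\<in>orbit p q. so.G x) = (\<Sum>x\<in>orbit p q. so.H x - so.avg)"
        by (intro sum.cong) (auto simp: so.G_def on_orbit)
      also have "\<dots> = birkhoff (\<lambda>x. so.H x - so.avg) p q"
        unfolding orbit_def birkhoff_def by (simp add: sum.reindex[OF inj])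
      also have "\<dots> = 0" using p by (simp add: birkhoff_minus_const so.avg_def)
      finally show ?thesis by (simp add: integral_orbit_measure[OF finite_orbit slip_G])
    qed
    moreover have "(\<integral>x. ?B x \<partial>?\<mu>) = (\<integral>x. so.G x \<partial>?\<mu>) + (\<beta> + so.avg)"
      unfolding int_B[OF orbit_measure_invariant[OF p q]]
      by (simp add: integral_orbit_measure[OF finite_orbit od] on_orbit)
    moreover have "0 < \<epsilon> * (\<integral>x. ?od x \<partial>\<nu>)" using eps od_pos by (rule mult_pos_pos)
    ultimately show "(\<integral>x. ?B x \<partial>\<nu>) < (\<integral>x. ?B x \<partial>?\<mu>)"
      using int_B[OF \<nu>] by linarith
  qed
qed

end

section \<open>Lipschitz functions and density\<close>

context shift_space
begin

lemma slip_abs: "slip K f \<Longrightarrow> slip \<bar>K\<bar> f"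
  by (erule slip_mono) simp

lemma lip_space_shift: "f \<in> lip_space sm \<longleftrightarrow> (\<exists>K. slip K f)"
  by (auto simp: lip_space_def Lipschitz_continuous_map_def slip_def dist_real_def
      mspace_shift_metric[OF theta_pos theta_less] mdist_shift_metric[OF theta_pos theta_less])

lemma lip_norm_shift:
  "lip_norm sm f = (SUP x. \<bar>f x\<bar>) + (SUP (x, y). \<bar>f x - f y\<bar> / sd x y)"
  by (simp add: lip_norm_def mspace_shift_metric[OF theta_pos theta_less]
      mdist_shift_metric[OF theta_pos theta_less])

lemma lip_norm_bdd:
  assumes "slip K f"
  shows "bdd_above (range (\<lambda>x. \<bar>f x\<bar>))" "bdd_above (range (\<lambda>(x, y). \<bar>f x - f y\<bar> / sd x y))"
proof -
  show "bdd_above (range (\<lambda>x. \<bar>f x\<bar>))"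
    using slip_le[OF assms] by (intro bdd_aboveI2) blast
  show "bdd_above (range (\<lambda>(x, y). \<bar>f x - f y\<bar> / sd x y))"
  proof (rule bdd_aboveI2, clarify)
    fix x y
    show "\<bar>f x - f y\<bar> / sd x y \<le> \<bar>K\<bar>"
      using slipD[OF slip_abs[OF assms], of x y] sd_nonneg[of x y]
      by (cases "sd x y = 0") (auto simp: divide_le_eq less_le)
  qed
qed

lemma lip_norm_upper:
  assumes f: "slip K f" and le: "lip_norm sm f \<le> \<rho>"
  shows "\<bar>f x\<bar> \<le> \<rho>" "slip \<rho> f"
proof -
  have a: "\<bar>f x\<bar> \<le> (SUP x. \<bar>f x\<bar>)" for x
    by (intro cSUP_upper lip_norm_bdd[OF f]) simp
  have b: "\<bar>f x - f y\<bar> / sd x y \<le> (SUP (x, y). \<bar>f x - f y\<bar> / sd x y)" for x y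
    using cSUP_upper[OF _ lip_norm_bdd(2)[OF f], of "(x, y)"] by simp
  show "\<bar>f x\<bar> \<le> \<rho>"
    using a[of x] b[of x x] le by (simp add: lip_norm_shift)
  have "\<bar>f x - f y\<bar> \<le> \<rho> * sd x y" for x y
  proof (cases "x = y")
    case False
    then have "0 < sd x y" by (simp add: less_le sd_eq_0_iff eq_commute[of 0])
    moreover have "\<bar>f x - f y\<bar> / sd x y \<le> \<rho>"
      using a[of x] b[of x y] le by (simp add: lip_norm_shift)
    ultimately show ?thesis by (simp add: divide_le_eq)
  qed simp
  then show "slip \<rho> f" by (simp add: slip_def)
qed

lemma lip_norm_least:
  assumes "slip \<rho> f" "\<And>x. \<bar>f x\<bar> \<le> \<rho>"
  shows "lip_norm sm f \<le> 2 * \<rho>"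
proof -
  have rho: "0 \<le> \<rho>" using assms(2)[of undefined] by linarith
  have "(SUP x. \<bar>f x\<bar>) \<le> \<rho>" using assms(2) by (intro cSUP_least) auto
  moreover have "(SUP (x, y). \<bar>f x - f y\<bar> / sd x y) \<le> \<rho>"
  proof (rule cSUP_least)
    show "(case z of (x, y) \<Rightarrow> \<bar>f x - f y\<bar> / sd x y) \<le> \<rho>" for z
    proof (cases z)
      case (Pair x y)
      then show ?thesis
        using slipD[OF assms(1), of x y] sd_nonneg[of x y] rho
        by (cases "sd x y = 0") (auto simp: divide_le_eq less_le)
    qed
  qed simp
  ultimately show ?thesis by (simp add: lip_norm_shift)
qed

lemma Metric_space_lip_shift: "Metric_space (lip_space sm) (lip_dist sm)"
  using Metric_space_mspace_mdist[of "lip_metric sm"]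
  unfolding mspace_lip_shift[OF theta_pos theta_less] mdist_lip_shift[OF theta_pos theta_less] .

lemma mtopology_lip_shift:
  "mtopology_of (lip_metric sm) = Metric_space.mtopology (lip_space sm) (lip_dist sm)"
  by (simp add: mtopology_of_def mspace_lip_shift[OF theta_pos theta_less]
      mdist_lip_shift[OF theta_pos theta_less])

lemma mean_value_perturb:
  assumes g: "slip L g" and \<phi>: "\<And>n. 1 \<le> n \<Longrightarrow> \<phi> n \<in> borel_measurable (mborel sm)"
    and close: "\<And>n x. 1 \<le> n \<Longrightarrow> \<bar>\<phi> n x - birkhoff g n x\<bar> \<le> B"
    and f: "slip K f" and \<nu>: "\<nu> \<in> invariant_measures sm shift"
  shows "mean_value (perturb shift \<phi> f) \<nu> = (\<integral>x. g x + f x \<partial>\<nu>)"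
proof -
  interpret invariant_measure \<theta> \<nu> by standard (rule \<nu>)
  have perturb: "perturb shift \<phi> f n x = \<phi> n x + birkhoff f n x" for n x
    by (simp add: perturb_def birkhoff_def)
  show ?thesis
  proof (rule mean_value_eq[OF slip_abs[OF slip_add[OF g f]] abs_ge_zero])
    fix n :: nat assume n: "1 \<le> n"
    obtain K1 where "slip K1 (birkhoff f n)" using slip_birkhoff[OF slip_abs[OF f]] by auto
    then have "birkhoff f n \<in> borel_measurable \<nu>" by (rule slip_measurable_nu)
    moreover have "\<phi> n \<in> borel_measurable \<nu>"
      using \<phi>[OF n] measurable_cong_sets[OF sets_nu refl] by blast
    ultimately show "perturb shift \<phi> f n \<in> borel_measurable \<nu>"
      unfolding perturb[abs_def] by simp
    show "\<bar>perturb shift \<phi> f n x - birkhoff (\<lambda>x. g x + f x) n x\<bar> \<le> B" for x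
      using close[OF n, of x] by (simp add: perturb birkhoff_plus)
  qed
qed

text \<open>The open dense set is the interior of the set \<open>S\<close> of good functions, so
  only density needs an argument: near each \<open>f\<close> lies an \<open>f'\<close> with a whole
  ball inside \<open>S\<close>.\<close>

lemma relative_TPO_of_close:
  fixes g :: "(nat \<Rightarrow> 'k::finite) \<Rightarrow> real"
  assumes g: "slip L g" and \<phi>: "\<And>n. 1 \<le> n \<Longrightarrow> \<phi> n \<in> borel_measurable (mborel sm)"
    and close: "\<And>n x. 1 \<le> n \<Longrightarrow> \<bar>\<phi> n x - birkhoff g n x\<bar> \<le> B"
  shows "relative_TPO sm shift \<phi>"
proof -
  interpret lip: Metric_space "lip_space (sm :: (nat \<Rightarrow> 'k) metric)" "lip_dist sm"
    by (rule Metric_space_lip_shift)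
  define S where "S = {f \<in> lip_space sm. \<exists>Q. periodic_orbit sm shift Q \<and>
    maximizing_measures sm shift (perturb shift \<phi> f) = {orbit_measure sm Q}}"
  have "f \<in> lip.mtopology closure_of (lip.mtopology interior_of S)" if f_lip: "f \<in> lip_space sm" for f
    unfolding lip.metric_closure_of
  proof (intro CollectI conjI allI impI f_lip)
    fix \<rho> :: real assume \<rho>: "0 < \<rho>"
    obtain K where f: "slip K f" using f_lip by (auto simp: lip_space_shift)
    \<comment> \<open>The penalty has supremum and Lipschitz constant at most \<open>e\<close>,
      hence norm at most \<open>2 * e\<close>, which is \<open>\<rho> / 2\<close>.\<close>
    define e where "e = \<rho> / 4"
    have e: "0 < e" using \<rho> by (simp add: e_def)
    obtain p q r where p: "1 \<le> p" and q: "(shift ^^ p) q = q" and r: "0 < r"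
      and max: "\<forall>h \<nu>. slip 1 h \<longrightarrow> (\<forall>x. \<bar>h x\<bar> \<le> r) \<longrightarrow> \<nu> \<in> invariant_measures sm shift \<longrightarrow>
        \<nu> \<noteq> orbit_measure sm (orbit p q) \<longrightarrow>
        (\<integral>x. (g x + f x) + h x - e * orbit_dist p q x \<partial>\<nu>)
          < (\<integral>x. (g x + f x) + h x - e * orbit_dist p q x \<partial>orbit_measure sm (orbit p q))"
      by (rule stable_periodic_maximizer[OF slip_abs[OF slip_add[OF g f]] abs_ge_zero e])
    let ?\<mu> = "orbit_measure sm (orbit p q)"
    have od: "slip e (\<lambda>x. e * orbit_dist p q x)"
      using slip_cmult[OF slip_orbit_dist[OF p q], of e] e by simp
    define f' where "f' x = f x - e * orbit_dist p q x" for x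
    have "slip (K + e) f'"
      unfolding f'_def[abs_def] using slip_add[OF f slip_uminus[OF od]] by simp
    then have f': "f' \<in> lip_space sm" by (auto simp: lip_space_shift)
    have "\<bar>e * orbit_dist p q x\<bar> \<le> e" for x
    proof -
      have "orbit_dist p q x \<le> 1"
        using orbit_dist_le[OF p q, of x 0] sd_le_1[of x "(shift ^^ 0) q"] by linarith
      then show ?thesis
        using e orbit_dist_nonneg[OF p, of q x] by (simp add: abs_mult)
    qed
    then have "lip_norm sm (\<lambda>x. f x - f' x) \<le> 2 * e"
      by (intro lip_norm_least) (use od in \<open>simp_all add: f'_def\<close>)
    then have near: "f' \<in> lip.mball f \<rho>"
      using f_lip f' \<rho> by (simp add: lip_dist_def e_def)
    \<comment> \<open>The norm controls both parts at once: radius 1 keeps the perturbation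
      1-Lipschitz, radius \<open>r\<close> keeps its supremum below \<open>r\<close>.\<close>
    have "lip.mball f' (min 1 r) \<subseteq> S"
    proof
      fix h assume "h \<in> lip.mball f' (min 1 r)"
      then have h: "h \<in> lip_space sm" "lip_dist sm f' h < min 1 r" by auto
      obtain K' where K': "slip K' h" using h(1) by (auto simp: lip_space_shift)
      define d where "d x = h x - f' x" for x
      have "lip_norm sm d \<le> min 1 r"
        using h f' lip.commute[of f' h] by (simp add: lip_dist_def d_def[abs_def])
      moreover have "slip (K' + (K + e)) d"
        unfolding d_def[abs_def]
        using slip_add[OF K' slip_uminus[OF \<open>slip (K + e) f'\<close>]] by simp
      ultimately have d: "slip (min 1 r) d" "\<bar>d x\<bar> \<le> min 1 r" for x
        using lip_norm_upper by blast+
      have d1: "slip 1 d" "\<bar>d x\<bar> \<le> r" for x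
        using slip_mono[OF d(1)] d(2)[of x] by auto
      have mean: "mean_value (perturb shift \<phi> h) \<nu>
          = (\<integral>x. (g x + f x) + d x - e * orbit_dist p q x \<partial>\<nu>)"
        if "\<nu> \<in> invariant_measures sm shift" for \<nu>
        using mean_value_perturb[OF g \<phi> close K' that] by (simp add: d_def f'_def algebra_simps)
      have inv: "?\<mu> \<in> invariant_measures sm shift" by (rule orbit_measure_invariant[OF p q])
      have less: "mean_value (perturb shift \<phi> h) \<nu> < mean_value (perturb shift \<phi> h) ?\<mu>"
        if "\<nu> \<in> invariant_measures sm shift" "\<nu> \<noteq> ?\<mu>" for \<nu>
        unfolding mean[OF that(1)] mean[OF inv] by (rule max[rule_format, OF d1 that])
      have "maximizing_measures sm shift (perturb shift \<phi> h) = {?\<mu>}"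
      proof (intro set_eqI iffI)
        fix \<nu> assume "\<nu> \<in> maximizing_measures sm shift (perturb shift \<phi> h)"
        then have "\<nu> \<in> invariant_measures sm shift"
          "mean_value (perturb shift \<phi> h) ?\<mu> \<le> mean_value (perturb shift \<phi> h) \<nu>"
          using inv by (auto simp: maximizing_measures_def)
        then show "\<nu> \<in> {?\<mu>}" using less[of \<nu>] by (metis not_less singletonI)
      next
        fix \<nu> assume "\<nu> \<in> {?\<mu>}"
        moreover have "mean_value (perturb shift \<phi> h) \<nu> \<le> mean_value (perturb shift \<phi> h) ?\<mu>"
          if "\<nu> \<in> invariant_measures sm shift" for \<nu>
          using less[OF that] by (cases "\<nu> = ?\<mu>") auto
        ultimately show "\<nu> \<in> maximizing_measures sm shift (perturb shift \<phi> h)"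
          using inv by (auto simp: maximizing_measures_def)
      qed
      moreover have "periodic_orbit sm shift (orbit p q)"
        using p q by (auto simp: periodic_orbit_def orbit_def
            mspace_shift_metric[OF theta_pos theta_less])
      ultimately show "h \<in> S" using h(1) by (auto simp: S_def)
    qed
    then have "lip.mball f' (min 1 r) \<subseteq> lip.mtopology interior_of S"
      by (intro interior_of_maximal) auto
    then have "f' \<in> lip.mtopology interior_of S" using f' r by auto
    then show "\<exists>f'\<in>lip.mtopology interior_of S. f' \<in> lip.mball f \<rho>" using near by blast
  qed
  then have "lip.mtopology closure_of (lip.mtopology interior_of S) = lip_space sm"
    using closure_of_subset_topspace[of lip.mtopology] by auto
  moreover have "lip.mtopology interior_of S \<subseteq> S" by (rule interior_of_subset)
  ultimately show ?thesis
    unfolding relative_TPO_def mtopology_lip_shift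
    by (intro exI[of _ "lip.mtopology interior_of S"]) (auto simp: S_def)
qed

text \<open>Two points either agree on the first \<open>n\<close> symbols, where \<open>f\<close>
  does not change, or are more than \<open>\<theta> ^ n\<close> apart, where a jump of
  \<open>2 * B\<close> is affordable.\<close>

lemma slip_of_coordinates:
  assumes coord: "\<And>x y. (\<And>i. i < n \<Longrightarrow> x i = y i) \<Longrightarrow> f x = f y" and B: "\<And>x. \<bar>f x\<bar> \<le> B"
  shows "slip (2 * B / \<theta> ^ n) f"
  unfolding slip_def
proof (intro allI)
  fix x y
  have B0: "0 \<le> B" using B[of x] by linarith
  show "\<bar>f x - f y\<bar> \<le> 2 * B / \<theta> ^ n * sd x y"
  proof (cases "sd x y \<le> \<theta> ^ n")
    case True
    then have "f x = f y" using coord unfolding sd_le_power_iff by blast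
    then show ?thesis using B0 theta_pos by simp
  next
    case False
    then have "2 * B / \<theta> ^ n * \<theta> ^ n \<le> 2 * B / \<theta> ^ n * sd x y"
      using B0 theta_pos by (intro mult_left_mono) auto
    moreover have "\<bar>f x - f y\<bar> \<le> 2 * B" using B[of x] B[of y] by linarith
    ultimately show ?thesis using theta_pos by simp
  qed
qed

end

section \<open>The rank-one cocycle\<close>

lemma rank1_matrix_vector: "rank1_matrix C i *v w = (row i C \<bullet> w) *\<^sub>R axis i 1"
  by (simp add: vec_eq_iff rank1_matrix_def matrix_vector_mult_def matrix_matrix_mult_def
      columnvector_def rowvector_def row_def inner_vec_def axis_def UNIV_1)

text \<open>Each adjacent pair of a row and a basis vector collapses to one entry of
  \<open>C\<close>. Hence \<open>n + 1\<close> factors produce only \<open>n\<close> entries, and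
  the outermost row and basis vector remain.\<close>

lemma cocycle_vector:
  "cocycle C (Suc n) x *v w
    = ((\<Prod>j<n. C $ x (Suc j) $ x j) * (row (x 0) C \<bullet> w)) *\<^sub>R axis (x n) 1"
proof (induction n)
  case 0
  show ?case by (simp add: rank1_matrix_vector)
next
  case (Suc n)
  have "cocycle C (Suc (Suc n)) x *v w = rank1_matrix C (x (Suc n)) *v (cocycle C (Suc n) x *v w)"
    by (simp add: matrix_vector_mul_assoc)
  also have "\<dots> = ((\<Prod>j<n. C $ x (Suc j) $ x j) * (row (x 0) C \<bullet> w))
      *\<^sub>R (row (x (Suc n)) C \<bullet> axis (x n) 1) *\<^sub>R axis (x (Suc n)) 1"
    unfolding Suc rank1_matrix_vector by simp
  also have "row (x (Suc n)) C \<bullet> axis (x n) 1 = C $ x (Suc n) $ x n"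
    by (simp add: inner_axis row_def)
  finally show ?case by (simp add: mult_ac)
qed

text \<open>Cauchy-Schwarz, with equality at \<open>w = a\<close>.\<close>

lemma onorm_inner_scaleR:
  fixes a :: "'a::real_inner" and b :: "'b::real_normed_vector"
  shows "onorm (\<lambda>w. (a \<bullet> w) *\<^sub>R b) = norm a * norm b"
proof (rule antisym)
  show "onorm (\<lambda>w. (a \<bullet> w) *\<^sub>R b) \<le> norm a * norm b"
  proof (rule onorm_bound)
    fix w
    have "\<bar>a \<bullet> w\<bar> * norm b \<le> norm a * norm w * norm b"
      by (intro mult_right_mono Cauchy_Schwarz_ineq2) simp
    then show "norm ((a \<bullet> w) *\<^sub>R b) \<le> norm a * norm b * norm w" by (simp add: mult_ac)
  qed simp
  show "norm a * norm b \<le> onorm (\<lambda>w. (a \<bullet> w) *\<^sub>R b)"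
  proof (cases "a = 0")
    case True
    then show ?thesis by (simp add: onorm_zero)
  next
    case False
    have "bounded_linear (\<lambda>w. (a \<bullet> w) *\<^sub>R b)"
      by (intro bounded_linear_scaleR_const bounded_linear_inner_right)
    then have "norm ((a \<bullet> a) *\<^sub>R b) \<le> onorm (\<lambda>w. (a \<bullet> w) *\<^sub>R b) * norm a"
      by (rule onorm)
    then show ?thesis using False by (simp add: power2_norm_eq_inner[symmetric] power2_eq_square)
  qed
qed

lemma row_nonzero:
  assumes "\<forall>i j. 0 < (C :: real ^ 'k ^ 'k) $ i $ j"
  shows "row i C \<noteq> 0"
proof
  assume "row i C = 0"
  then have "row i C $ i = 0" by simp
  then show False using assms by (metis less_irrefl row_def vec_lambda_beta)
qed

text \<open>The operator norm of a rank-one map is a product of norms, so the formula is exact: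
  \<open>n + 1\<close> matrices give a Birkhoff sum of length \<open>n\<close> and a term for the
  first row, while the last basis vector has norm 1. Positivity of \<open>C\<close> allows the
  logarithm to be split.\<close>

lemma cocycle_potential_Suc:
  assumes C: "\<forall>i j. 0 < (C :: real ^ 'k ^ 'k) $ i $ j"
  shows "cocycle_potential C (Suc n) x
    = birkhoff (\<lambda>x. ln (C $ x 1 $ x 0)) n x + ln (norm (row (x 0) C))"
proof -
  let ?P = "\<Prod>j<n. C $ x (Suc j) $ x j"
  have P: "0 < ?P" using C by (intro prod_pos) auto
  have "(\<lambda>w. cocycle C (Suc n) x *v w) = (\<lambda>w. ((?P *\<^sub>R row (x 0) C) \<bullet> w) *\<^sub>R axis (x n) 1)"
    by (simp only: cocycle_vector inner_scaleR_left)
  then have "onorm (\<lambda>w. cocycle C (Suc n) x *v w) = ?P * norm (row (x 0) C)"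
    using P by (simp only: onorm_inner_scaleR norm_axis_1) simp
  moreover have "ln ?P = (\<Sum>j<n. ln (C $ x (Suc j) $ x j))"
  proof (rule ln_prod)
    show "C $ x (Suc j) $ x j \<noteq> 0" for j using C by (metis less_irrefl)
  qed simp
  moreover have "ln (?P * norm (row (x 0) C)) = ln ?P + ln (norm (row (x 0) C))"
    by (rule ln_mult_pos[OF P]) (simp add: row_nonzero[OF C])
  ultimately show ?thesis
    unfolding cocycle_potential_def birkhoff_def by (simp only: funpow_shift add_0_right) simp
qed

section \<open>Regularity of the cocycle potential\<close>

context shift_space
begin

context
  fixes C :: "real ^ 'k ^ 'k"
  assumes C: "\<forall>i j. 0 < C $ i $ j"
begin

abbreviation step_potential :: "(nat \<Rightarrow> 'k) \<Rightarrow> real" where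
  "step_potential x \<equiv> ln (C $ x 1 $ x 0)"

abbreviation start_potential :: "(nat \<Rightarrow> 'k) \<Rightarrow> real" where
  "start_potential x \<equiv> ln (norm (row (x 0) C))"

lemma potentials_bounded:
  obtains B where "\<And>x. \<bar>step_potential x\<bar> \<le> B" "\<And>x. \<bar>start_potential x\<bar> \<le> B"
proof -
  have "bdd_above (range (\<lambda>(i, j). \<bar>ln (C $ i $ j)\<bar>))" by (rule bdd_above_finite) simp
  then obtain B1 where B1: "\<And>i j. \<bar>ln (C $ i $ j)\<bar> \<le> B1"
    by (fastforce simp: bdd_above_def)
  have "bdd_above (range (\<lambda>i. \<bar>ln (norm (row i C))\<bar>))" by (rule bdd_above_finite) simp
  then obtain B2 where B2: "\<And>i. \<bar>ln (norm (row i C))\<bar> \<le> B2"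
    by (fastforce simp: bdd_above_def)
  show ?thesis
  proof
    show "\<bar>step_potential x\<bar> \<le> max B1 B2" for x using B1[of "x 1" "x 0"] by linarith
    show "\<bar>start_potential x\<bar> \<le> max B1 B2" for x using B2[of "x 0"] by linarith
  qed
qed

lemma slip_potentials:
  obtains K where "0 \<le> K" "slip K step_potential" "slip K start_potential"
proof -
  obtain B where B: "\<And>x. \<bar>step_potential x\<bar> \<le> B" "\<And>x. \<bar>start_potential x\<bar> \<le> B"
    by (rule potentials_bounded) blast
  have B0: "0 \<le> B" using B(1)[of undefined] by linarith
  have a: "slip (2 * B / \<theta> ^ 2) step_potential"
  proof (rule slip_of_coordinates[OF _ B(1)])
    fix x y :: "nat \<Rightarrow> 'k" assume "\<And>i. i < 2 \<Longrightarrow> x i = y i"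
    from this[of 0] this[of 1] show "step_potential x = step_potential y" by simp
  qed
  have b: "slip (2 * B / \<theta> ^ 1) start_potential"
  proof (rule slip_of_coordinates[OF _ B(2)])
    fix x y :: "nat \<Rightarrow> 'k" assume "\<And>i. i < 1 \<Longrightarrow> x i = y i"
    from this[of 0] show "start_potential x = start_potential y" by simp
  qed
  have "0 \<le> 2 * B / \<theta> ^ 2" "0 \<le> 2 * B / \<theta> ^ 1" using B0 theta_pos by simp_all
  then show ?thesis
    using that[of "2 * B / \<theta> ^ 2 + 2 * B / \<theta> ^ 1"] slip_mono[OF a] slip_mono[OF b] by simp
qed

lemma cocycle_potential_close:
  obtains B where "0 \<le> B"
    "\<And>n x. 1 \<le> n \<Longrightarrow> \<bar>cocycle_potential C n x - birkhoff step_potential n x\<bar> \<le> B"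
proof -
  obtain B where B: "\<And>x. \<bar>step_potential x\<bar> \<le> B" "\<And>x. \<bar>start_potential x\<bar> \<le> B"
    by (rule potentials_bounded) blast
  show ?thesis
  \<comment> \<open>One \<open>B\<close> for the last step missing from the exact formula, one for
    the first row.\<close>
  proof (rule that[of "2 * B"])
    show "0 \<le> 2 * B" using B(1)[of undefined] by linarith
    show "\<bar>cocycle_potential C n x - birkhoff step_potential n x\<bar> \<le> 2 * B" if n: "1 \<le> n" for n x
    proof -
      obtain l where l: "n = Suc l" using n by (cases n) auto
      show ?thesis
        unfolding l cocycle_potential_Suc[OF C] birkhoff_Suc
        using B(1)[of "(shift ^^ l) x"] B(2)[of x] by linarith
    qed
  qed
qed

lemma slip_cocycle_potential:
  assumes "1 \<le> n"
  obtains K where "slip K (cocycle_potential C n)"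
proof -
  obtain l where l: "n = Suc l" using assms by (cases n) auto
  obtain K where K: "0 \<le> K" "slip K step_potential" "slip K start_potential"
    by (rule slip_potentials)
  obtain K1 where "slip K1 (birkhoff step_potential l)" using slip_birkhoff[OF K(2,1)] by blast
  then show ?thesis
    using that slip_add[OF _ K(3)] unfolding l cocycle_potential_Suc[OF C, abs_def] by blast
qed

lemma almost_additive_cocycle_potential: "almost_additive sm shift (cocycle_potential C)"
proof -
  obtain B where B: "0 \<le> B"
    "\<And>n x. 1 \<le> n \<Longrightarrow> \<bar>cocycle_potential C n x - birkhoff step_potential n x\<bar> \<le> B"
    by (rule cocycle_potential_close) blast
  have "\<bar>cocycle_potential C (n + l) x - cocycle_potential C n x
      - cocycle_potential C l ((shift ^^ n) x)\<bar> \<le> 3 * B" if "1 \<le> n" "1 \<le> l" for n l x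
    using B(2)[of "n + l" x] B(2)[OF that(1), of x] B(2)[OF that(2), of "(shift ^^ n) x"]
      birkhoff_add[of step_potential n l x] that(1) by (simp add: abs_le_iff)
  then have "bdd_above {\<bar>cocycle_potential C (n + l) x - cocycle_potential C n x
      - cocycle_potential C l ((shift ^^ n) x)\<bar> | n l x. 1 \<le> n \<and> 1 \<le> l \<and> x \<in> mspace sm}"
    by (intro bdd_aboveI[of _ "3 * B"]) blast
  moreover have "continuous_map (mtopology_of sm) euclideanreal (cocycle_potential C n)"
    if "1 \<le> n" for n
    using slip_cocycle_potential[OF that] slip_continuous by metis
  ultimately show ?thesis by (simp add: almost_additive_def)
qed

text \<open>The Birkhoff part is estimated term by term, and the first-row term by the summand
  \<open>j = 0\<close> of the denominator; each accounts for one \<open>K\<close>.\<close>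

lemma orbit_Lipschitz_cocycle_potential: "orbit_Lipschitz sm shift (cocycle_potential C)"
proof -
  obtain K where K: "0 \<le> K" "slip K step_potential" "slip K start_potential"
    by (rule slip_potentials)
  have "\<bar>cocycle_potential C n x - cocycle_potential C n y\<bar>
      / (\<Sum>j<n. sd ((shift ^^ j) x) ((shift ^^ j) y)) \<le> 2 * K"
    if n: "1 \<le> n" and xy: "x \<noteq> y" for n x y
  proof -
    let ?S = "\<lambda>n. \<Sum>j<n. sd ((shift ^^ j) x) ((shift ^^ j) y)"
    obtain l where l: "n = Suc l" using n by (cases n) auto
    have "\<bar>birkhoff step_potential l x - birkhoff step_potential l y\<bar>
        \<le> (\<Sum>j<l. \<bar>step_potential ((shift ^^ j) x) - step_potential ((shift ^^ j) y)\<bar>)"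
      unfolding birkhoff_def sum_subtractf[symmetric] by (rule sum_abs)
    also have "\<dots> \<le> (\<Sum>j<l. K * sd ((shift ^^ j) x) ((shift ^^ j) y))"
      by (intro sum_mono slipD[OF K(2)])
    also have "\<dots> = K * ?S l" by (simp add: sum_distrib_left)
    also have "\<dots> \<le> K * ?S n" using K(1) by (intro mult_left_mono) (simp_all add: l)
    finally have a: "\<bar>birkhoff step_potential l x - birkhoff step_potential l y\<bar> \<le> K * ?S n" .
    have S: "sd x y \<le> ?S n"
      unfolding l by (subst sum.lessThan_Suc_shift) (simp add: sum_nonneg)
    then have "K * sd x y \<le> K * ?S n" using K(1) by (intro mult_left_mono)
    then have "\<bar>start_potential x - start_potential y\<bar> \<le> K * ?S n"
      using slipD[OF K(3), of x y] by linarith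
    with a have "\<bar>cocycle_potential C n x - cocycle_potential C n y\<bar> \<le> 2 * K * ?S n"
      unfolding l cocycle_potential_Suc[OF C] by linarith
    moreover have "0 < sd x y" using xy by (simp add: less_le sd_eq_0_iff eq_commute[of 0])
    ultimately show ?thesis using S by (simp add: pos_divide_le_eq)
  qed
  then show ?thesis
    unfolding orbit_Lipschitz_def mdist_shift_metric[OF theta_pos theta_less]
    by (intro bdd_aboveI[of _ "2 * K"]) blast
qed

lemma relative_TPO_cocycle_potential: "relative_TPO sm shift (cocycle_potential C)"
proof -
  obtain K where K: "slip K step_potential" by (rule slip_potentials)
  obtain B where B:
    "\<And>n x. 1 \<le> n \<Longrightarrow> \<bar>cocycle_potential C n x - birkhoff step_potential n x\<bar> \<le> B"
    by (rule cocycle_potential_close) blast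
  show ?thesis
    by (rule relative_TPO_of_close[OF K _ B]) (metis slip_cocycle_potential slip_measurable)
qed

end
end

theorem proposition7p1:
  fixes C :: "real ^ 'k ^ 'k" and \<theta> :: real
  assumes "2 \<le> CARD('k)"
    and "0 < \<theta>" and "\<theta> < 1"
    and "\<forall>i j. 0 < C $ i $ j"
  shows "almost_additive (shift_metric \<theta>) shift (cocycle_potential C) \<and>
         orbit_Lipschitz (shift_metric \<theta>) shift (cocycle_potential C) \<and>
         relative_TPO (shift_metric \<theta>) shift (cocycle_potential C) \<and>
         (\<exists>G. openin (mtopology_of (lip_metric (shift_metric \<theta>))) G \<and>
              mtopology_of (lip_metric (shift_metric \<theta>)) closure_of G = lip_space (shift_metric \<theta>) \<and>
              (\<forall>f\<in>G. \<exists>Q. periodic_orbit (shift_metric \<theta>) shift Q \<and>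
                 maximizing_measures (shift_metric \<theta>) shift (perturb shift (cocycle_potential C) f) =
                   {orbit_measure (shift_metric \<theta>) Q}))"
proof -
  interpret shift_space \<theta> by standard (fact assms)+
  note TPO = relative_TPO_cocycle_potential[OF assms(4)]
  show ?thesis
    using almost_additive_cocycle_potential[OF assms(4)]
      orbit_Lipschitz_cocycle_potential[OF assms(4)] TPO TPO[unfolded relative_TPO_def]
    by blast
qed

end
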